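(* Let $u=u(x,t)$ with $u(\cdot,t)\in C^4(a,b)$ be a solution of the continuous problem $$u_t+u_{xxxxt}=f(u)_x \ \text{ in } (a,b)\times(0,T],\qquad u(x,0)=u_0(x),\ x\in(a,b),\qquad u(a,t)=u(b,t)=u_x(a,t)=u_x(b,t)=0. \quad (P)$$ Then $u$ satisfies the weak formulation: for $s>7/2$, $$(u_t,v)+B(u_t,v)=(f(u)_x,v)\quad\text{for all } v\in H^s(\mathcal{E}_h),\ t>0,\qquad u(x,0)=u_0(x). \quad (W)$$ Conversely, if $u$ with $u(\cdot,t)\in H^2(a,b)\cap H^s(\mathcal{E}_h)$, $s>7/2$, is a solution of (W), then $u$ satisfies (P).
   Context: Nonlinearity: $f(u)=\sum_{i=1}^{n} \frac{c_i u^{p_i+1}}{p_i+1}$ with $c_i$ real constants and $p_i$ positive integers. The solution $u$ of (P) is assumed sufficiently smooth (so that $u_t$ and $u_{xt}$ are continuous across nodes). Mesh: $a=x_0<x_1<\dots<x_N=b$, $I_n=(x_n,x_{n+1})$, $\mathcal{E}_h=\{I_0,\dots,I_{N-1}\}$, $h=\max_n(x_{n+1}-x_n)$. Broken Sobolev space: $H^s(\mathcal{E}_h)=\{v\in L^2(a,b): v|_{I_n}\in H^s(I_n)\ \forall I_n\in\mathcal{E}_h\}$. $(\cdot,\cdot)$ is the $L^2(a,b)$ inner product, with $x$-derivatives of piecewise functions taken elementwise. Jumps and averages: at interior nodes $[v(x_n)]=v(x_n^-)-v(x_n^+)$ and $\{v(x_n)\}=\frac12(v(x_n^-)+v(x_n^+))$;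 at the boundary $[v(x_0)]=-v(x_0)$, $[v(x_N)]=v(x_N)$, $\{v(x_0)\}=v(x_0)$, $\{v(x_N)\}=v(x_N)$. Bilinear form: with penalty parameters $\sigma_0,\sigma_1>0$ and an exponent $\beta$, $$B(u,v)=\sum_{n=0}^{N-1}\int_{x_n}^{x_{n+1}}u_{xx}v_{xx}\,dx+\sum_{n=0}^N\big(\{u_{xxx}(x_n)\}[v(x_n)]+\{v_{xxx}(x_n)\}[u(x_n)]\big)-\sum_{n=0}^N\big(\{u_{xx}(x_n)\}[v_x(x_n)]+\{v_{xx}(x_n)\}[u_x(x_n)]\big)$$ $$\qquad+\sum_{n=0}^N\frac{\sigma_0}{h^\beta}[u(x_n)][v(x_n)]+\sum_{n=0}^N\frac{\sigma_1}{h}[u_x(x_n)][v_x(x_n)].$$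
   Formalization: In the converse, u_0 is additionally assumed to satisfy u_0 = u_0' = 0 at a and b (otherwise u = u_0 = 1 solves (W) but not (P)), with u, u_x continuous in time down to t = 0 and u_t also in H^2(a,b) and H^s(E_h); u_xxxxt is read as the fourth x-derivative of u_t. *)

theory Defs
  imports "HOL-Analysis.Analysis"
begin

section \<open>Sobolev spaces on a bounded interval\<close>

definition L2 :: "real \<Rightarrow> real \<Rightarrow> (real \<Rightarrow> real) set" where
  "L2 c d = {v. v \<in> borel_measurable (lebesgue_on {c<..<d}) \<and>
                integrable (lebesgue_on {c<..<d}) (\<lambda>x. (v x)\<^sup>2)}"

definition test_function :: "real \<Rightarrow> real \<Rightarrow> (real \<Rightarrow> real) \<Rightarrow> bool" where
  "test_function c d \<phi> \<longleftrightarrow>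
     (\<forall>k x. ((deriv ^^ k) \<phi>) field_differentiable (at x)) \<and>
     (\<exists>c' d'. c < c' \<and> c' \<le> d' \<and> d' < d \<and> (\<forall>x. x \<notin> {c'..d'} \<longrightarrow> \<phi> x = 0))"

definition locally_integrable :: "real \<Rightarrow> real \<Rightarrow> (real \<Rightarrow> real) \<Rightarrow> bool" where
  "locally_integrable c d v \<longleftrightarrow>
     (\<forall>c' d'. c < c' \<and> c' \<le> d' \<and> d' < d \<longrightarrow> v absolutely_integrable_on {c'..d'})"

definition is_weak_deriv ::
  "real \<Rightarrow> real \<Rightarrow> nat \<Rightarrow> (real \<Rightarrow> real) \<Rightarrow> (real \<Rightarrow> real) \<Rightarrow> bool" where
  "is_weak_deriv c d k v g \<longleftrightarrow>
     locally_integrable c d v \<and> locally_integrable c d g \<and>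
     (\<forall>\<phi>. test_function c d \<phi> \<longrightarrow>
        (LINT x:{c<..<d}|lebesgue. v x * (deriv ^^ k) \<phi> x) =
        (- 1) ^ k * (LINT x:{c<..<d}|lebesgue. g x * \<phi> x))"

text \<open>Square of the Gagliardo seminorm of order \<open>\<theta> \<in> (0,1)\<close>. On the diagonal the integrand is
  \<open>0 / 0 = 0\<close>, which is harmless because the diagonal is a null set.\<close>

definition gagliardo :: "real \<Rightarrow> real \<Rightarrow> real \<Rightarrow> (real \<Rightarrow> real) \<Rightarrow> ennreal" where
  "gagliardo \<theta> c d g =
     (\<integral>\<^sup>+x. (\<integral>\<^sup>+y. ennreal ((g x - g y)\<^sup>2 / \<bar>x - y\<bar> powr (1 + 2 * \<theta>))
        \<partial>lebesgue_on {c<..<d}) \<partial>lebesgue_on {c<..<d})"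

text \<open>The (Sobolev-Slobodeckij) space \<open>H\<^sup>s(c,d)\<close> for real \<open>s \<ge> 0\<close>. Its elements are represented by
  functions; membership depends only on the values on \<open>(c,d)\<close>, up to null sets.\<close>

definition sobolev :: "real \<Rightarrow> real \<Rightarrow> real \<Rightarrow> (real \<Rightarrow> real) set" where
  "sobolev s c d = {v \<in> L2 c d.
     (\<forall>j \<le> nat \<lfloor>s\<rfloor>. \<exists>g \<in> L2 c d. is_weak_deriv c d j v g) \<and>
     (frac s \<noteq> 0 \<longrightarrow>
        (\<exists>g \<in> L2 c d. is_weak_deriv c d (nat \<lfloor>s\<rfloor>) v g \<and> gagliardo (frac s) c d g < \<infinity>))}"

text \<open>A choice of the weak derivative, which is unique up to null sets.\<close>

definition wderiv :: "real \<Rightarrow> real \<Rightarrow> nat \<Rightarrow> (real \<Rightarrow> real) \<Rightarrow> real \<Rightarrow> real" where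
  "wderiv c d k v = (SOME g. is_weak_deriv c d k v g)"

text \<open>The representative that is continuous on the closed interval; its values on \<open>[c,d]\<close> are unique,
  and those at \<open>c\<close> and \<open>d\<close> are the traces of \<open>g\<close>.\<close>

definition cont_rep :: "real \<Rightarrow> real \<Rightarrow> (real \<Rightarrow> real) \<Rightarrow> real \<Rightarrow> real" where
  "cont_rep c d g = (SOME r. continuous_on {c..d} r \<and> (AE x in lebesgue_on {c<..<d}. r x = g x))"

section \<open>Mesh, broken spaces, jumps and averages\<close>

definition mesh :: "real \<Rightarrow> real \<Rightarrow> nat \<Rightarrow> (nat \<Rightarrow> real) \<Rightarrow> bool" where
  "mesh a b N X \<longleftrightarrow> X 0 = a \<and> X N = b \<and> (\<forall>n<N. X n < X (Suc n))"

definition mesh_size :: "nat \<Rightarrow> (nat \<Rightarrow> real) \<Rightarrow> real" where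
  "mesh_size N X = Max ((\<lambda>n. X (Suc n) - X n) ` {..<N})"

definition broken_sobolev :: "real \<Rightarrow> nat \<Rightarrow> (nat \<Rightarrow> real) \<Rightarrow> (real \<Rightarrow> real) set" where
  "broken_sobolev s N X = {v \<in> L2 (X 0) (X N). \<forall>n<N. v \<in> sobolev s (X n) (X (Suc n))}"

definition broken_deriv ::
  "nat \<Rightarrow> (nat \<Rightarrow> real) \<Rightarrow> nat \<Rightarrow> (real \<Rightarrow> real) \<Rightarrow> real \<Rightarrow> real" where
  "broken_deriv N X k v x =
     (\<Sum>n<N. indicator {X n<..<X (Suc n)} x * wderiv (X n) (X (Suc n)) k v x)"

definition l2_inner :: "real \<Rightarrow> real \<Rightarrow> (real \<Rightarrow> real) \<Rightarrow> (real \<Rightarrow> real) \<Rightarrow> real" where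
  "l2_inner a b v w = (LINT x:{a<..<b}|lebesgue. v x * w x)"

text \<open>\<open>trace_minus X k v n\<close> and \<open>trace_plus X k v n\<close> are the one-sided values at the node \<open>X n\<close> of the
  elementwise \<open>k\<close>-th derivative of \<open>v\<close>, taken from the elements to the left and to the right.
  They are meaningful for \<open>n \<ge> 1\<close> and \<open>n < N\<close>, respectively.\<close>

definition trace_minus :: "(nat \<Rightarrow> real) \<Rightarrow> nat \<Rightarrow> (real \<Rightarrow> real) \<Rightarrow> nat \<Rightarrow> real" where
  "trace_minus X k v n = cont_rep (X (n - 1)) (X n) (wderiv (X (n - 1)) (X n) k v) (X n)"

definition trace_plus :: "(nat \<Rightarrow> real) \<Rightarrow> nat \<Rightarrow> (real \<Rightarrow> real) \<Rightarrow> nat \<Rightarrow> real" where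
  "trace_plus X k v n = cont_rep (X n) (X (Suc n)) (wderiv (X n) (X (Suc n)) k v) (X n)"

definition jump :: "nat \<Rightarrow> (nat \<Rightarrow> real) \<Rightarrow> nat \<Rightarrow> (real \<Rightarrow> real) \<Rightarrow> nat \<Rightarrow> real" where
  "jump N X k v n =
     (if n = 0 then - trace_plus X k v n
      else if n = N then trace_minus X k v n
      else trace_minus X k v n - trace_plus X k v n)"

definition average :: "nat \<Rightarrow> (nat \<Rightarrow> real) \<Rightarrow> nat \<Rightarrow> (real \<Rightarrow> real) \<Rightarrow> nat \<Rightarrow> real" where
  "average N X k v n =
     (if n = 0 then trace_plus X k v n
      else if n = N then trace_minus X k v n
      else (trace_minus X k v n + trace_plus X k v n) / 2)"

definition bilinear_B ::
  "nat \<Rightarrow> (nat \<Rightarrow> real) \<Rightarrow> real \<Rightarrow> real \<Rightarrow> real \<Rightarrow> (real \<Rightarrow> real) \<Rightarrow> (real \<Rightarrow> real) \<Rightarrow> real" where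
  "bilinear_B N X \<sigma>0 \<sigma>1 \<beta> u v =
     (\<Sum>n<N. LINT x:{X n<..<X (Suc n)}|lebesgue.
        wderiv (X n) (X (Suc n)) 2 u x * wderiv (X n) (X (Suc n)) 2 v x)
     + (\<Sum>n\<le>N. average N X 3 u n * jump N X 0 v n + average N X 3 v n * jump N X 0 u n)
     - (\<Sum>n\<le>N. average N X 2 u n * jump N X 1 v n + average N X 2 v n * jump N X 1 u n)
     + (\<Sum>n\<le>N. \<sigma>0 / mesh_size N X powr \<beta> * jump N X 0 u n * jump N X 0 v n)
     + (\<Sum>n\<le>N. \<sigma>1 / mesh_size N X * jump N X 1 u n * jump N X 1 v n)"

section \<open>The continuous problem and its weak formulation\<close>

definition nonlinearity :: "nat \<Rightarrow> (nat \<Rightarrow> real) \<Rightarrow> (nat \<Rightarrow> nat) \<Rightarrow> real \<Rightarrow> real" where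
  "nonlinearity m c p z = (\<Sum>i=1..m. c i * z ^ (p i + 1) / real (p i + 1))"

text \<open>Classical \<open>k\<close> times continuous differentiability on \<open>S\<close>, one-sided at boundary points in \<open>S\<close>;
  \<open>D j\<close> is the \<open>j\<close>-th derivative.\<close>

definition Ck_on :: "nat \<Rightarrow> real set \<Rightarrow> (real \<Rightarrow> real) \<Rightarrow> bool" where
  "Ck_on k S g \<longleftrightarrow> (\<exists>D :: nat \<Rightarrow> real \<Rightarrow> real.
     (\<forall>x\<in>S. D 0 x = g x) \<and>
     (\<forall>j<k. \<forall>x\<in>S. (D j has_real_derivative D (Suc j) x) (at x within S)) \<and>
     continuous_on S (D k))"

text \<open>Throughout, \<open>u t x\<close> stands for \<open>u(x,t)\<close>. The derivatives below are one-sided at the ends of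
  \<open>[a,b]\<close> and \<open>[0,T]\<close>.\<close>

definition x_deriv :: "real \<Rightarrow> real \<Rightarrow> (real \<Rightarrow> real) \<Rightarrow> real \<Rightarrow> real" where
  "x_deriv a b g x = vector_derivative g (at x within {a..b})"

definition t_deriv :: "real \<Rightarrow> (real \<Rightarrow> real \<Rightarrow> real) \<Rightarrow> real \<Rightarrow> real \<Rightarrow> real" where
  "t_deriv T u t x = vector_derivative (\<lambda>\<tau>. u \<tau> x) (at t within {0..T})"

text \<open>The standing smoothness assumption: \<open>u\<close> and \<open>u\<^sub>x\<close> are differentiable in time for \<open>t > 0\<close> and
  continuous in time up to \<open>t = 0\<close>, \<open>u\<^sub>t\<close> and \<open>u\<^sub>x\<^sub>t\<close> are continuous in space, hence across the
  nodes, and \<open>u\<^sub>x\<^sub>t = u\<^sub>t\<^sub>x\<close>.\<close>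

definition smooth_evolution ::
  "real \<Rightarrow> real \<Rightarrow> real \<Rightarrow> (real \<Rightarrow> real \<Rightarrow> real) \<Rightarrow> bool" where
  "smooth_evolution a b T u \<longleftrightarrow>
     (\<forall>t\<in>{0..T}. Ck_on 1 {a..b} (u t)) \<and>
     (\<forall>x\<in>{a..b}. continuous_on {0..T} (\<lambda>t. u t x) \<and>
                  continuous_on {0..T} (\<lambda>t. x_deriv a b (u t) x)) \<and>
     (\<forall>t\<in>{0<..T}. Ck_on 1 {a..b} (t_deriv T u t) \<and>
        (\<forall>x\<in>{a..b}.
           ((\<lambda>\<tau>. u \<tau> x) has_real_derivative t_deriv T u t x) (at t within {0..T}) \<and>
           ((\<lambda>\<tau>. x_deriv a b (u \<tau>) x) has_real_derivative x_deriv a b (t_deriv T u t) x)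
             (at t within {0..T})))"

definition clamped :: "real \<Rightarrow> real \<Rightarrow> (real \<Rightarrow> real) \<Rightarrow> bool" where
  "clamped a b g \<longleftrightarrow>
     g a = 0 \<and> g b = 0 \<and>
     (g has_real_derivative 0) (at a within {a..b}) \<and>
     (g has_real_derivative 0) (at b within {a..b})"

text \<open>\<open>u\<^sub>x\<^sub>x\<^sub>x\<^sub>x\<^sub>t\<close> is read as \<open>\<partial>\<^sub>x\<^sup>4 (u\<^sub>t)\<close>, in accordance with the form \<open>B(u\<^sub>t, v)\<close> below.\<close>

definition solves_P ::
  "real \<Rightarrow> real \<Rightarrow> real \<Rightarrow> (real \<Rightarrow> real) \<Rightarrow> (real \<Rightarrow> real) \<Rightarrow> (real \<Rightarrow> real \<Rightarrow> real) \<Rightarrow> bool" where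
  "solves_P a b T f u0 u \<longleftrightarrow>
     (\<forall>t\<in>{0<..T}.
        Ck_on 4 {a<..<b} (t_deriv T u t) \<and>
        (\<forall>x\<in>{a<..<b}.
           (\<lambda>\<tau>. u \<tau> x) differentiable (at t within {0..T}) \<and>
           (\<lambda>y. f (u t y)) differentiable (at x) \<and>
           t_deriv T u t x + (deriv ^^ 4) (t_deriv T u t) x = deriv (\<lambda>y. f (u t y)) x)) \<and>
     (\<forall>x\<in>{a<..<b}. u 0 x = u0 x) \<and>
     (\<forall>t\<in>{0<..T}. clamped a b (u t))"

definition solves_W ::
  "real \<Rightarrow> real \<Rightarrow> real \<Rightarrow> nat \<Rightarrow> (nat \<Rightarrow> real) \<Rightarrow> real \<Rightarrow> real \<Rightarrow> real \<Rightarrow> real \<Rightarrow>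
   (real \<Rightarrow> real) \<Rightarrow> (real \<Rightarrow> real) \<Rightarrow> (real \<Rightarrow> real \<Rightarrow> real) \<Rightarrow> bool" where
  "solves_W a b T N X s \<sigma>0 \<sigma>1 \<beta> f u0 u \<longleftrightarrow>
     (\<forall>t\<in>{0<..T}. \<forall>v \<in> broken_sobolev s N X.
        l2_inner a b (t_deriv T u t) v + bilinear_B N X \<sigma>0 \<sigma>1 \<beta> (t_deriv T u t) v
          = l2_inner a b (broken_deriv N X 1 (\<lambda>y. f (u t y))) v) \<and>
     (\<forall>x\<in>{a<..<b}. u 0 x = u0 x)"

end

theory Submission
  imports Defs
begin

text \<open>
  Fix a time \<open>t > 0\<close> and write \<open>w\<close> for the time derivative of \<open>u\<close> and \<open>F\<close> for the \<open>x\<close>-derivative of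
  \<open>f(u)\<close>. Both \<open>w\<close> and \<open>F\<close> are continuous on the closed interval \<open>[a,b]\<close>. In either direction the
  first goal is that \<open>w\<close> has the weak fourth derivative \<open>F - w\<close> on \<open>(a,b)\<close>. By the du Bois-Reymond
  lemma, \<open>w\<close> then differs from a fourfold antiderivative of \<open>F - w\<close> by a polynomial, so that \<open>w\<close> is
  four times continuously differentiable up to the boundary and \<open>w + \<partial>\<^sub>x\<^sup>4 w = F\<close> holds pointwise
  (\<open>weak_deriv_continuous_imp_chain\<close>). For a solution of the continuous problem the weak equation is
  an integration by parts on the open interval. For a solution of the weak formulation it follows by
  testing with smooth functions of compact support in \<open>(a,b)\<close>: their jumps vanish, the jumps of \<open>w\<close> vanish at
  interior nodes because \<open>w\<close> is continuously differentiable, and the elementwise second derivatives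
  of \<open>w\<close> are restrictions of one weak derivative because \<open>w\<close> lies in \<open>H\<^sup>2(a,b)\<close>
  (\<open>weak_form_imp_weak_deriv\<close>).

  Once \<open>w\<close> is this regular, two integrations by parts on each element turn
  \<open>(w,v) + B(w,v) - (F,v)\<close> into a sum over the nodes in which every term contains a jump of \<open>w\<close> or of
  its derivative (\<open>broken_green\<close>, \<open>weak_form_residual\<close>). Only the two ends of the interval contribute.
  If \<open>u\<close> is clamped, so is \<open>w\<close>, and the residual is zero: this is the weak formulation.
  Conversely, if the residual is zero for all \<open>v\<close>, polynomials \<open>v\<close> which vanish together with
  their first derivative at both ends and have prescribed second and third derivatives there make \<open>w\<close> and its derivative
  vanish at \<open>a\<close> and \<open>b\<close> (\<open>boundary_terms_eq_0_imp_clamped\<close>). The boundary values of \<open>u\<close> and of its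
  \<open>x\<close>-derivative are therefore constant in time, and they are zero at time \<open>0\<close> because the initial
  value is clamped.

  The integrations by parts have to be justified for a test function \<open>v\<close> with weak derivatives only.
  Two weak derivatives in \<open>L\<^sup>2\<close> make \<open>v\<close> and its first derivative absolutely continuous on each closed
  element (\<open>sobolev_2_structure\<close>), and Fubini's theorem then gives the integration by parts against a
  continuously differentiable function (\<open>integration_by_parts_abs_continuous\<close>).
\<close>

section \<open>Smooth functions and test functions\<close>

definition smooth :: "(real \<Rightarrow> real) \<Rightarrow> bool" where
  "smooth f \<longleftrightarrow> (\<forall>k x. (deriv ^^ k) f field_differentiable at x)"

text \<open>Closure of smoothness under products is an induction on the order, and the induction needs a
  notion for finitely many derivatives.\<close>

definition ndiff :: "nat \<Rightarrow> (real \<Rightarrow> real) \<Rightarrow> bool" where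
  "ndiff n f \<longleftrightarrow> (\<forall>k\<le>n. \<forall>x. (deriv ^^ k) f field_differentiable at x)"

lemma smooth_iff_ndiff: "smooth f \<longleftrightarrow> (\<forall>n. ndiff n f)"
  by (auto simp: smooth_def ndiff_def)

lemma ndiff_0 [simp]: "ndiff 0 f \<longleftrightarrow> (\<forall>x. f field_differentiable at x)"
  by (simp add: ndiff_def)

lemma ndiff_Suc: "ndiff (Suc n) f \<longleftrightarrow> (\<forall>x. f field_differentiable at x) \<and> ndiff n (deriv f)"
proof -
  have "(\<forall>k\<le>Suc n. \<forall>x. (deriv ^^ k) f field_differentiable at x) \<longleftrightarrow>
     (\<forall>x. f field_differentiable at x) \<and> (\<forall>k\<le>n. \<forall>x. (deriv ^^ Suc k) f field_differentiable at x)"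
    by (metis Suc_le_mono bot_nat_0.extremum funpow_0 old.nat.exhaust)
  then show ?thesis unfolding ndiff_def funpow_Suc_right by simp
qed

lemma ndiff_mono: "ndiff n f \<Longrightarrow> m \<le> n \<Longrightarrow> ndiff m f"
  by (auto simp: ndiff_def)

lemma ndiff_add: "ndiff n f \<Longrightarrow> ndiff n g \<Longrightarrow> ndiff n (\<lambda>x. f x + g x)"
proof (induction n arbitrary: f g)
  case (Suc n)
  then have *: "\<And>x. f field_differentiable at x" "\<And>x. g field_differentiable at x"
    by (simp_all add: ndiff_Suc)
  then have "deriv (\<lambda>x. f x + g x) = (\<lambda>x. deriv f x + deriv g x)"
    by (auto simp: fun_eq_iff)
  with Suc * show ?case by (simp add: ndiff_Suc field_differentiable_add)
qed (simp add: field_differentiable_add)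

lemma ndiff_mult: "ndiff n f \<Longrightarrow> ndiff n g \<Longrightarrow> ndiff n (\<lambda>x. f x * g x)"
proof (induction n arbitrary: f g)
  case (Suc n)
  then have *: "\<And>x. f field_differentiable at x" "\<And>x. g field_differentiable at x"
    by (simp_all add: ndiff_Suc)
  then have "deriv (\<lambda>x. f x * g x) = (\<lambda>x. f x * deriv g x + deriv f x * g x)"
    by (auto simp: fun_eq_iff)
  moreover have "ndiff n f" "ndiff n g" using Suc.prems ndiff_mono[of "Suc n"] by auto
  ultimately show ?case using Suc * by (simp add: ndiff_Suc field_differentiable_mult ndiff_add)
qed (simp add: field_differentiable_mult)

lemma smooth_add: "smooth f \<Longrightarrow> smooth g \<Longrightarrow> smooth (\<lambda>x. f x + g x)"
  by (simp add: smooth_iff_ndiff ndiff_add)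

lemma smooth_mult: "smooth f \<Longrightarrow> smooth g \<Longrightarrow> smooth (\<lambda>x. f x * g x)"
  by (simp add: smooth_iff_ndiff ndiff_mult)

lemma smooth_higher_deriv: "smooth f \<Longrightarrow> smooth ((deriv ^^ k) f)"
  by (simp add: smooth_def funpow_add[symmetric, unfolded o_def, THEN fun_cong] flip: funpow_add[unfolded o_def, THEN fun_cong])

lemma smooth_deriv: "smooth f \<Longrightarrow> smooth (deriv f)"
  using smooth_higher_deriv[of f 1] by simp

lemma smooth_has_deriv:
  "smooth f \<Longrightarrow> ((deriv ^^ k) f has_real_derivative (deriv ^^ Suc k) f x) (at x within S)"
  unfolding smooth_def by (metis DERIV_deriv_iff_field_differentiable has_field_derivative_at_within funpow.simps(2) o_apply)

lemma smooth_continuous: "smooth f \<Longrightarrow> continuous_on S ((deriv ^^ k) f)"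
  by (meson DERIV_continuous_on smooth_has_deriv)

text \<open>A class of functions that is closed under differentiation consists of smooth functions. Explicit
  families (polynomials, affine substitutions, \<open>flat_exp\<close>) are handled this way without a
  formula for the higher derivatives.\<close>

lemma smooth_coinduct:
  assumes "P f" and "\<And>f. P f \<Longrightarrow> \<exists>g. P g \<and> (\<forall>x. (f has_real_derivative g x) (at x))"
  shows "smooth f"
proof -
  have "P ((deriv ^^ k) f)" for k
  proof (induction k)
    case (Suc k)
    then obtain g where g: "P g" "\<forall>x. ((deriv ^^ k) f has_real_derivative g x) (at x)"
      using assms(2) by blast
    then have "(deriv ^^ Suc k) f = g" by (auto simp: fun_eq_iff DERIV_imp_deriv)
    then show ?case using g by simp
  qed (use assms(1) in simp)
  then show ?thesis unfolding smooth_def using assms(2) field_differentiable_def by blast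
qed

lemma smooth_poly: "smooth (poly P)"
  by (rule smooth_coinduct[where P = "\<lambda>f. \<exists>P. f = poly P"]) (auto intro: poly_DERIV)

lemma higher_deriv_poly: "(deriv ^^ k) (poly P) = poly ((pderiv ^^ k) P)"
proof (induction k)
  case (Suc k)
  then have "(deriv ^^ Suc k) (poly P) = deriv (poly ((pderiv ^^ k) P))" by simp
  also have "\<dots> = poly ((pderiv ^^ Suc k) P)"
    by (simp add: fun_eq_iff DERIV_imp_deriv[OF poly_DERIV])
  finally show ?case .
qed simp

lemma smooth_const: "smooth (\<lambda>_. c)"
  by (rule smooth_coinduct[where P = "\<lambda>f. \<exists>c. f = (\<lambda>_. c)"]) (auto intro: exI[of _ 0])

lemma smooth_affine:
  assumes "smooth f"
  shows "smooth (\<lambda>x. f (r * x + q))"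
proof (rule smooth_coinduct[where P = "\<lambda>g. \<exists>f c. smooth f \<and> g = (\<lambda>x. c * f (r * x + q))"])
  show "\<exists>f' c. smooth f' \<and> (\<lambda>x. f (r * x + q)) = (\<lambda>x. c * f' (r * x + q))"
    using assms by (intro exI[of _ f] exI[of _ 1]) simp
next
  fix g assume "\<exists>f c. smooth f \<and> g = (\<lambda>x. c * f (r * x + q))"
  then obtain f c where f: "smooth f" "g = (\<lambda>x. c * f (r * x + q))" by blast
  have "(g has_real_derivative (c * r) * deriv f (r * x + q)) (at x)" for x
  proof -
    have "((\<lambda>x. f (r * x + q)) has_real_derivative deriv f (r * x + q) * r) (at x)"
      by (rule DERIV_chain2[of f]) (use smooth_has_deriv[OF f(1), of 0] in \<open>auto intro!: derivative_eq_intros\<close>)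
    from DERIV_cmult[OF this, of c] show ?thesis by (simp add: f(2) mult_ac)
  qed
  with f(1) show "\<exists>g'. (\<exists>f c. smooth f \<and> g' = (\<lambda>x. c * f (r * x + q))) \<and>
      (\<forall>x. (g has_real_derivative g' x) (at x))"
    by (intro exI[of _ "\<lambda>x. (c * r) * deriv f (r * x + q)"]) (blast intro: smooth_deriv)
qed

text \<open>The standard smooth function that vanishes on the negative half-line. The polynomial factor is
  there because the derivatives of \<open>exp (- 1 / x)\<close> are again of this form.\<close>

definition flat_exp :: "real poly \<Rightarrow> real \<Rightarrow> real" where
  "flat_exp P x = (if x > 0 then poly P (1 / x) * exp (- (1 / x)) else 0)"

lemma poly_times_exp_minus_tendsto_0: "((\<lambda>y. poly P y * exp (- y)) \<longlongrightarrow> 0) at_top" for P :: "real poly"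
proof -
  have "((\<lambda>y. \<Sum>i\<le>degree P. coeff P i * (y ^ i / exp y)) \<longlongrightarrow> (\<Sum>i\<le>degree P. coeff P i * 0)) at_top"
    by (intro tendsto_sum tendsto_mult tendsto_const tendsto_power_div_exp_0)
  then show ?thesis by (simp add: poly_altdef exp_minus sum_distrib_right divide_inverse mult.assoc)
qed

text \<open>Away from \<open>0\<close> this is the chain rule. At \<open>0\<close> the right difference quotient is \<open>y P(y) exp (- y)\<close>
  with \<open>y = 1 / h\<close> tending to infinity.\<close>

lemma flat_exp_has_deriv:
  "(flat_exp P has_real_derivative flat_exp (monom 1 2 * (P - pderiv P)) x) (at x)"
proof -
  consider "x > 0" | "x < 0" | "x = 0" by linarith
  then show ?thesis
  proof cases
    case 1
    have "((\<lambda>x. poly P (1 / x) * exp (- (1 / x))) has_real_derivative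
            flat_exp (monom 1 2 * (P - pderiv P)) x) (at x)"
      using 1 by (auto intro!: derivative_eq_intros DERIV_chain2[OF poly_DERIV]
          simp: flat_exp_def poly_monom field_simps power2_eq_square)
    then show ?thesis
      by (rule has_field_derivative_transform_within_open[of _ _ _ "{0<..}"]) (use 1 in \<open>auto simp: flat_exp_def\<close>)
  next
    case 2
    have "((\<lambda>x. 0) has_real_derivative flat_exp (monom 1 2 * (P - pderiv P)) x) (at x)"
      using 2 by (simp add: flat_exp_def)
    then show ?thesis
      by (rule has_field_derivative_transform_within_open[of _ _ _ "{..<0}"]) (use 2 in \<open>auto simp: flat_exp_def\<close>)
  next
    case 3
    have "((\<lambda>h. poly (pCons 0 P) (inverse h) * exp (- inverse h)) \<longlongrightarrow> 0) (at_right 0)"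
      by (rule filterlim_compose[OF poly_times_exp_minus_tendsto_0 filterlim_inverse_at_top_right])
    then have "((\<lambda>h. (flat_exp P h - flat_exp P 0) / (h - 0)) \<longlongrightarrow> 0) (at_right 0)"
      by (rule Lim_transform_eventually)
        (auto simp: flat_exp_def eventually_at_right_field field_simps intro!: exI[of _ 1])
    moreover have "((\<lambda>h. (flat_exp P h - flat_exp P 0) / (h - 0)) \<longlongrightarrow> 0) (at_left 0)"
      by (rule Lim_transform_eventually[OF tendsto_const])
        (auto simp: flat_exp_def eventually_at_left_field intro!: exI[of _ "-1"])
    ultimately have "((\<lambda>h. (flat_exp P h - flat_exp P 0) / (h - 0)) \<longlongrightarrow> 0) (at 0)"
      by (simp add: filterlim_split_at)
    then show ?thesis using 3 by (simp add: has_field_derivative_iff flat_exp_def)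
  qed
qed

lemma smooth_flat_exp: "smooth (flat_exp P)"
  by (rule smooth_coinduct[where P = "\<lambda>f. \<exists>P. f = flat_exp P"]) (auto intro: flat_exp_has_deriv)

lemma test_function_iff:
  "test_function c d \<phi> \<longleftrightarrow> smooth \<phi> \<and>
     (\<exists>c' d'. c < c' \<and> c' \<le> d' \<and> d' < d \<and> (\<forall>x. x \<notin> {c'..d'} \<longrightarrow> \<phi> x = 0))"
  by (simp add: test_function_def smooth_def)

text \<open>A function vanishes together with all its derivatives off a compact set, and enlarging that set
  slightly makes them vanish at the ends of an interval as well.\<close>

lemma test_function_obtain:
  assumes "test_function c d \<phi>"
  obtains c' d' where "c < c'" "c' < d'" "d' < d" "\<And>x k. x \<notin> {c'<..<d'} \<Longrightarrow> (deriv ^^ k) \<phi> x = 0"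
proof -
  obtain l r where *: "c < l" "l \<le> r" "r < d" "\<And>x. x \<notin> {l..r} \<Longrightarrow> \<phi> x = 0" and "smooth \<phi>"
    using assms unfolding test_function_iff by blast
  have "(deriv ^^ k) \<phi> x = 0" if "x \<notin> {l..r}" for k x
    using that
  proof (induction k arbitrary: x)
    case (Suc k)
    have "((\<lambda>_. 0) has_real_derivative 0) (at x)" by simp
    then have "((deriv ^^ k) \<phi> has_real_derivative 0) (at x)"
      by (rule has_field_derivative_transform_within_open[of _ _ _ "- {l..r}"])
        (use Suc in \<open>auto simp: open_Compl\<close>)
    then show ?case by (simp add: DERIV_imp_deriv)
  qed (use * in simp)
  then show ?thesis
    using * by (intro that[of "(c + l) / 2" "(r + d) / 2"]) (auto simp: field_simps)
qed

lemma test_function_higher_deriv: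
  assumes "test_function c d \<phi>" shows "test_function c d ((deriv ^^ k) \<phi>)"
proof -
  obtain c' d' where "c < c'" "c' < d'" "d' < d" "\<And>x k. x \<notin> {c'<..<d'} \<Longrightarrow> (deriv ^^ k) \<phi> x = 0"
    by (rule test_function_obtain[OF assms]) blast
  then have "c < c' \<and> c' \<le> d' \<and> d' < d \<and> (\<forall>x. x \<notin> {c'..d'} \<longrightarrow> (deriv ^^ k) \<phi> x = 0)" by auto
  then show ?thesis using assms smooth_higher_deriv unfolding test_function_iff by blast
qed

lemma test_function_mono: "test_function c d \<phi> \<Longrightarrow> a \<le> c \<Longrightarrow> d \<le> b \<Longrightarrow> test_function a b \<phi>"
  unfolding test_function_def by (meson less_le_trans le_less_trans)

text \<open>On \<open>(l,r)\<close> this is \<open>exp (- (1 / (x - l) + 1 / (r - x)) / (n + 1))\<close>, the \<open>(n + 1)\<close>-st root of the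
  usual bump function; the roots increase to the indicator function of \<open>(l,r)\<close>.\<close>

definition bump :: "real \<Rightarrow> real \<Rightarrow> nat \<Rightarrow> real \<Rightarrow> real" where
  "bump l r n x = flat_exp 1 (real (Suc n) * (x - l)) * flat_exp 1 (real (Suc n) * (r - x))"

lemma test_function_bump:
  assumes "c < l" "l < r" "r < d" shows "test_function c d (bump l r n)"
proof -
  have "smooth (bump l r n)"
    using smooth_mult[OF smooth_affine[OF smooth_flat_exp, of 1 "Suc n" "- (Suc n * l)"]
        smooth_affine[OF smooth_flat_exp, of 1 "- Suc n" "Suc n * r"]]
    by (simp add: bump_def[abs_def] algebra_simps)
  moreover have "x \<notin> {l..r} \<Longrightarrow> bump l r n x = 0" for x
    by (auto simp: bump_def flat_exp_def zero_less_mult_iff)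
  ultimately show ?thesis using assms unfolding test_function_iff by (meson less_imp_le)
qed

lemma bump_nonneg: "0 \<le> bump l r n x" and bump_le_1: "bump l r n x \<le> 1"
proof -
  have "0 \<le> flat_exp 1 y" "flat_exp 1 y \<le> 1" for y by (auto simp: flat_exp_def)
  then show "0 \<le> bump l r n x" "bump l r n x \<le> 1"
    by (auto simp: bump_def intro: mult_le_one)
qed

lemma bump_tendsto: "(\<lambda>n. bump l r n x) \<longlonglongrightarrow> indicator {l<..<r} x"
proof -
  have *: "(\<lambda>n. flat_exp 1 (real (Suc n) * z)) \<longlonglongrightarrow> (if z > 0 then 1 else 0)" for z
  proof (cases "z > 0")
    case True
    have "(\<lambda>n. exp (- (inverse (real (Suc n)) * (1 / z)))) \<longlonglongrightarrow> exp (- (0 * (1 / z)))"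
      by (intro tendsto_intros LIMSEQ_inverse_real_of_nat)
    moreover have "flat_exp 1 (real (Suc n) * z) = exp (- (inverse (real (Suc n)) * (1 / z)))" for n
      using True by (simp add: flat_exp_def zero_less_mult_iff field_simps del: of_nat_Suc)
    ultimately show ?thesis using True by simp
  next
    case False
    then have "flat_exp 1 (real (Suc n) * z) = 0" for n
      by (simp add: flat_exp_def zero_less_mult_iff)
    with False show ?thesis by simp
  qed
  have "(\<lambda>n. bump l r n x) \<longlonglongrightarrow> (if x - l > 0 then 1 else 0) * (if r - x > 0 then 1 else 0)"
    unfolding bump_def by (intro tendsto_mult *)
  then show ?thesis by (simp add: indicator_def if_distrib split: if_splits)
qed

section \<open>The fundamental lemma of the calculus of variations\<close>

lemma absolutely_integrable_on_open_iff:
  fixes h :: "real \<Rightarrow> real"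
  shows "h absolutely_integrable_on {c<..<d} \<longleftrightarrow> h absolutely_integrable_on {c..d}"
  using absolutely_integrable_on_open_interval[where f = h and a = c and b = d] by simp

lemma LINT_open_eq_integral:
  fixes h :: "real \<Rightarrow> real"
  assumes "h absolutely_integrable_on {c..d}"
  shows "(LINT x:{c<..<d}|lebesgue. h x) = integral {c..d} h"
  using assms by (metis absolutely_integrable_on_open_iff integral_open_interval_real set_lebesgue_integral_eq_integral(2))

lemma absolutely_integrable_times_continuous:
  fixes h p :: "real \<Rightarrow> real"
  assumes "h absolutely_integrable_on {c..d}" "continuous_on {c..d} p"
  shows "(\<lambda>x. h x * p x) absolutely_integrable_on {c..d}"
    and "(\<lambda>x. p x * h x) absolutely_integrable_on {c..d}"
proof -
  show "(\<lambda>x. p x * h x) absolutely_integrable_on {c..d}"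
    using assms by (intro absolutely_integrable_bounded_measurable_product_real
        continuous_imp_measurable_on_sets_lebesgue compact_imp_bounded compact_continuous_image) auto
  then show "(\<lambda>x. h x * p x) absolutely_integrable_on {c..d}" by (simp add: mult.commute)
qed

lemma absolutely_integrable_cong_AE:
  fixes h g :: "real \<Rightarrow> real"
  assumes "AE x in lebesgue_on {c<..<d}. h x = g x" "h absolutely_integrable_on {c..d}"
  shows "g absolutely_integrable_on {c..d}" "integral {c..d} g = integral {c..d} h"
proof -
  have "AE x in lebesgue. x \<in> {c<..<d} \<longrightarrow> h x = g x"
    using assms(1) by (simp add: AE_restrict_space_iff)
  then obtain N where N: "N \<in> null_sets lebesgue" "{x. \<not> (x \<in> {c<..<d} \<longrightarrow> h x = g x)} \<subseteq> N"
    unfolding eventually_ae_filter by auto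
  have neg: "negligible (N \<union> {c, d})" using N(1) by (simp add: negligible_iff_null_sets)
  have eq: "g x = h x" if "x \<in> {c..d} - (N \<union> {c, d})" for x using N(2) that by force
  show "g absolutely_integrable_on {c..d}"
    by (rule absolutely_integrable_spike[OF assms(2) neg eq])
  show "integral {c..d} g = integral {c..d} h"
    by (rule integral_spike[OF neg]) (use eq in auto)
qed

lemma locally_integrable_continuous:
  "continuous_on {c<..<d} f \<Longrightarrow> locally_integrable c d f"
  unfolding locally_integrable_def
  by (auto intro!: absolutely_integrable_continuous_real intro: continuous_on_subset)

lemma locally_integrable_absolutely:
  "f absolutely_integrable_on {c..d} \<Longrightarrow> locally_integrable c d f"
  unfolding locally_integrable_def
  by (auto intro: set_integrable_subset)

lemma locally_integrable_diff:
  "locally_integrable c d f \<Longrightarrow> locally_integrable c d g \<Longrightarrow> locally_integrable c d (\<lambda>x. f x - g x)"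
  unfolding locally_integrable_def by (auto intro: set_integral_diff)

text \<open>Local integrability gives control on compact subintervals only, so integrals against a test function
  are moved to an interval that contains its support.\<close>

lemma integral_times_test:
  assumes h: "locally_integrable c d h" and "c < c'" "c' < d'" "d' < d"
    and \<psi>: "continuous_on UNIV \<psi>" "\<And>x. x \<notin> {c'<..<d'} \<Longrightarrow> \<psi> x = 0"
  shows "(\<lambda>x. h x * \<psi> x) absolutely_integrable_on {c<..<d}"
    and "(LINT x:{c<..<d}|lebesgue. h x * \<psi> x) = integral {c'..d'} (\<lambda>x. h x * \<psi> x)"
proof -
  have *: "(\<lambda>x. h x * \<psi> x) absolutely_integrable_on {c'..d'}"
    using h assms unfolding locally_integrable_def
    by (intro absolutely_integrable_times_continuous(1)) (auto intro: continuous_on_subset)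
  have eq: "(\<lambda>x. indicat_real {c<..<d} x *\<^sub>R (h x * \<psi> x)) = (\<lambda>x. indicat_real {c'..d'} x *\<^sub>R (h x * \<psi> x))"
    using assms by (auto simp: fun_eq_iff indicator_def)
  show "(\<lambda>x. h x * \<psi> x) absolutely_integrable_on {c<..<d}"
    using * unfolding set_integrable_def eq .
  show "(LINT x:{c<..<d}|lebesgue. h x * \<psi> x) = integral {c'..d'} (\<lambda>x. h x * \<psi> x)"
    using set_lebesgue_integral_eq_integral(2)[OF *] unfolding set_lebesgue_integral_def eq .
qed

lemma integrable_times_test:
  assumes h: "locally_integrable c d h" and \<phi>: "test_function c d \<phi>"
  shows "(\<lambda>x. h x * (deriv ^^ k) \<phi> x) absolutely_integrable_on {c<..<d}"
proof -
  obtain c' d' where *: "c < c'" "c' < d'" "d' < d" "\<And>x k. x \<notin> {c'<..<d'} \<Longrightarrow> (deriv ^^ k) \<phi> x = 0"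
    by (rule test_function_obtain[OF \<phi>]) blast
  show ?thesis
    by (rule integral_times_test(1)[OF h *(1-3)])
      (use * \<phi> in \<open>auto simp: test_function_iff smooth_continuous\<close>)
qed

lemmas integrable_times_test0 = integrable_times_test[where k = 0, simplified]

lemma LINT_diff_test:
  assumes "locally_integrable c d h" "locally_integrable c d g" "test_function c d \<phi>"
  shows "(LINT x:{c<..<d}|lebesgue. (h x - g x) * (deriv ^^ k) \<phi> x) =
    (LINT x:{c<..<d}|lebesgue. h x * (deriv ^^ k) \<phi> x) - (LINT x:{c<..<d}|lebesgue. g x * (deriv ^^ k) \<phi> x)"
  using assms by (simp add: left_diff_distrib set_integral_diff integrable_times_test)

text \<open>The sets over which the integral vanishes contain the intervals and form a Dynkin system, hence
  contain all Borel sets; a Lebesgue set differs from a Borel set by a null set.\<close>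

lemma interval_integrals_zero_imp_AE_zero:
  fixes h :: "real \<Rightarrow> real"
  assumes h: "h absolutely_integrable_on {c..d}"
    and z: "\<And>l r. c \<le> l \<Longrightarrow> l < r \<Longrightarrow> r \<le> d \<Longrightarrow> integral {l..r} h = 0"
  shows "AE x in lebesgue. x \<in> {c..d} \<longrightarrow> h x = 0"
proof -
  define g where "g = (\<lambda>x. indicator {c..d} x *\<^sub>R h x)"
  have g: "integrable lebesgue g" using h by (simp add: g_def set_integrable_def)
  have ind: "set_integrable lebesgue A g" if "A \<in> sets lebesgue" for A
    unfolding set_integrable_def by (rule integrable_mult_indicator[OF that g])
  have int: "(LINT x:{l..r}|lebesgue. g x) = 0" if "l \<le> r" for l r
  proof -
    have "set_integrable lebesgue {max c l..min d r} h"
      by (rule set_integrable_subset[OF h]) auto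
    then have "(LINT x:{max c l..min d r}|lebesgue. h x) = integral {max c l..min d r} h"
      by (rule set_lebesgue_integral_eq_integral)
    also have "\<dots> = 0"
      using z[of "max c l" "min d r"] by (cases "max c l" "min d r" rule: linorder_cases) auto
    finally show ?thesis
      by (auto simp: set_lebesgue_integral_def g_def indicator_def of_bool_def if_distrib
          conj_ac cong: if_cong elim!: back_subst[of "\<lambda>f. integral\<^sup>L lebesgue f = 0"])
  qed
  have total: "(LINT x|lebesgue. g x) = 0"
  proof (cases "c \<le> d")
    case True
    from int[OF this] show ?thesis
      by (simp add: set_lebesgue_integral_def g_def flip: mult.assoc indicator_inter_arith)
  qed (simp add: g_def)
  have borel: "(LINT x:A|lebesgue. g x) = 0" if "A \<in> sets borel" for A
    using that
  proof (induction A rule: borel_set_induct)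
    case (compl A)
    have "(LINT x:A \<union> -A|lebesgue. g x) = (LINT x:A|lebesgue. g x) + (LINT x:-A|lebesgue. g x)"
      using compl by (intro set_integral_Un ind) auto
    then show ?case using compl total by (simp add: set_lebesgue_integral_def)
  next
    case (union f)
    have "(LINT x:(\<Union>i. f i)|lebesgue. g x) = (\<Sum>i. (LINT x:(f i)|lebesgue. g x))"
      using union by (intro lebesgue_integral_countable_add ind) (auto simp: disjoint_family_on_def)
    then show ?case using union by simp
  qed (use int in \<open>auto simp: set_lebesgue_integral_def\<close>)
  have "(LINT x:A|lebesgue. g x) = 0" if A: "A \<in> sets lebesgue" for A
  proof -
    obtain S N N' where S: "A = S \<union> N" "N \<subseteq> N'" "N' \<in> null_sets lborel" "S \<in> sets lborel"
      using sets_completionE[OF A] .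
    have "AE x in lebesgue. x \<notin> N'"
      using S(3) by (metis AE_not_in null_sets_completionI)
    then have "AE x in lebesgue. (x \<in> A) = (x \<in> S)"
      by eventually_elim (use S in auto)
    then have "(LINT x:A|lebesgue. g x) = (LINT x:S|lebesgue. g x)"
      using ind A S(4) unfolding set_integrable_def set_lebesgue_integral_def
      by (intro integral_cong_AE) (auto elim!: eventually_mono simp: indicator_def borel_measurable_integrable)
    then show ?thesis using borel S(4) by simp
  qed
  then have "AE x in lebesgue. g x = 0"
    by (intro density_unique_real g) auto
  then show ?thesis by eventually_elim (auto simp: g_def)
qed

text \<open>By dominated convergence along the bump functions, the integral of \<open>h\<close> over every compact
  subinterval vanishes.\<close>

lemma fundamental_lemma_calculus_of_variations:
  assumes h: "locally_integrable c d h"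
    and z: "\<And>\<phi>. test_function c d \<phi> \<Longrightarrow> (LINT x:{c<..<d}|lebesgue. h x * \<phi> x) = 0"
  shows "AE x in lebesgue_on {c<..<d}. h x = 0"
proof -
  have int0: "integral {l..r} h = 0" if lr: "c < l" "l < r" "r < d" for l r
  proof -
    have hi: "h absolutely_integrable_on {l..r}" using h lr by (simp add: locally_integrable_def)
    have "(\<lambda>n. integral {l<..<r} (\<lambda>x. h x * bump l r n x)) \<longlonglongrightarrow> integral {l<..<r} (\<lambda>x. h x * indicator {l<..<r} x)"
    proof (rule dominated_convergence(2)[where h = "\<lambda>x. \<bar>h x\<bar>"])
      have "smooth (bump l r n)" for n using test_function_bump[OF lr] by (simp add: test_function_iff)
      then show "(\<lambda>x. h x * bump l r n x) integrable_on {l<..<r}" for n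
        using absolutely_integrable_times_continuous(1)[OF hi smooth_continuous[of _ _ 0]]
        by (metis absolutely_integrable_on_open_iff funpow_0 set_lebesgue_integral_eq_integral(1))
      show "(\<lambda>x. \<bar>h x\<bar>) integrable_on {l<..<r}"
        using hi by (metis absolutely_integrable_on_open_iff set_lebesgue_integral_eq_integral(1) set_integrable_abs)
      show "norm (h x * bump l r n x) \<le> \<bar>h x\<bar>" for n x
        using bump_nonneg[of l r n x] bump_le_1[of l r n x] by (simp add: abs_mult mult_left_le)
      show "(\<lambda>n. h x * bump l r n x) \<longlonglongrightarrow> h x * indicator {l<..<r} x" for x
        by (intro tendsto_mult bump_tendsto tendsto_const)
    qed
    moreover have "integral {l<..<r} (\<lambda>x. h x * bump l r n x) = 0" for n
    proof -
      have "bump l r n x = 0" if "x \<notin> {l<..<r}" for x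
        using that by (auto simp: bump_def flat_exp_def zero_less_mult_iff)
      moreover have "continuous_on UNIV (bump l r n)"
        using test_function_bump[OF lr, of n] smooth_continuous[of _ _ 0] by (auto simp: test_function_iff)
      ultimately have "(LINT x:{c<..<d}|lebesgue. h x * bump l r n x) = integral {l..r} (\<lambda>x. h x * bump l r n x)"
        by (intro integral_times_test(2)[OF h lr]) auto
      then show ?thesis using z[OF test_function_bump[OF lr]] by (simp add: integral_open_interval_real)
    qed
    moreover have "integral {l<..<r} (\<lambda>x. h x * indicator {l<..<r} x) = integral {l..r} h"
      by (subst integral_open_interval_real) (intro integral_cong, auto)
    ultimately show ?thesis by (simp add: LIMSEQ_unique)
  qed
  have "AE x in lebesgue. \<forall>n. x \<in> {c + 1 / Suc n..d - 1 / Suc n} \<longrightarrow> h x = 0"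
    unfolding AE_all_countable
  proof
    fix n
    show "AE x in lebesgue. x \<in> {c + 1 / Suc n..d - 1 / Suc n} \<longrightarrow> h x = 0"
    proof (rule interval_integrals_zero_imp_AE_zero)
      show "h absolutely_integrable_on {c + 1 / Suc n..d - 1 / Suc n}"
        using h unfolding locally_integrable_def
        by (cases "c + 1 / Suc n \<le> d - 1 / Suc n") auto
      show "integral {l..r} h = 0" if "c + 1 / Suc n \<le> l" "l < r" "r \<le> d - 1 / Suc n" for l r
      proof (rule int0)
        have "0 < 1 / real (Suc n)" by simp
        then show "c < l" "r < d" using that by linarith+
      qed fact
    qed
  qed
  then have "AE x in lebesgue. x \<in> {c<..<d} \<longrightarrow> h x = 0"
  proof eventually_elim
    case (elim x)
    show ?case
    proof
      assume x: "x \<in> {c<..<d}"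
      then obtain n where "inverse (real (Suc n)) < min (x - c) (d - x)"
        using reals_Archimedean[of "min (x - c) (d - x)"] by auto
      then have "x \<in> {c + 1 / Suc n..d - 1 / Suc n}" by (auto simp: field_simps)
      then show "h x = 0" using elim by blast
    qed
  qed
  then show ?thesis by (simp add: AE_restrict_space_iff)
qed

section \<open>Derivative chains, weak derivatives and traces\<close>

text \<open>Carrying the whole list of derivatives avoids iterating \<open>deriv\<close>, which is meaningless at the
  endpoints of a closed interval.\<close>

definition deriv_chain :: "nat \<Rightarrow> real set \<Rightarrow> (nat \<Rightarrow> real \<Rightarrow> real) \<Rightarrow> bool" where
  "deriv_chain k S D \<longleftrightarrow>
     (\<forall>j<k. \<forall>x\<in>S. (D j has_real_derivative D (Suc j) x) (at x within S)) \<and> continuous_on S (D k)"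

lemma deriv_chainD: "deriv_chain k S D \<Longrightarrow> j < k \<Longrightarrow> x \<in> S \<Longrightarrow> (D j has_real_derivative D (Suc j) x) (at x within S)"
  by (simp add: deriv_chain_def)

lemma deriv_chain_continuous: "deriv_chain k S D \<Longrightarrow> j \<le> k \<Longrightarrow> continuous_on S (D j)"
  unfolding deriv_chain_def using DERIV_continuous_on[of S "D j" "D (Suc j)"]
  by (cases "j = k") auto

lemma deriv_chain_shift: "deriv_chain (Suc k) S D \<Longrightarrow> deriv_chain k S (\<lambda>j. D (Suc j))"
  by (simp add: deriv_chain_def)

lemma deriv_chain_subset: "deriv_chain k S D \<Longrightarrow> S' \<subseteq> S \<Longrightarrow> deriv_chain k S' D"
  unfolding deriv_chain_def by (meson has_field_derivative_subset continuous_on_subset subset_iff)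

lemma deriv_chain_le: "deriv_chain k S D \<Longrightarrow> j \<le> k \<Longrightarrow> deriv_chain j S D"
  using deriv_chain_continuous by (simp add: deriv_chain_def)

lemma Ck_on_iff_chain: "Ck_on k S g \<longleftrightarrow> (\<exists>D. (\<forall>x\<in>S. D 0 x = g x) \<and> deriv_chain k S D)"
  by (simp add: Ck_on_def deriv_chain_def)

lemma smooth_chain: "smooth \<phi> \<Longrightarrow> deriv_chain k S (\<lambda>j. (deriv ^^ j) \<phi>)"
  unfolding deriv_chain_def using smooth_has_deriv smooth_continuous by blast

lemma deriv_chain_higher_deriv:
  assumes "deriv_chain k S D" "open S" "\<forall>x\<in>S. D 0 x = g x" "j \<le> k" "x \<in> S"
  shows "(deriv ^^ j) g x = D j x"
  using assms(4,5)
proof (induction j arbitrary: x)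
  case (Suc j)
  have "(D j has_real_derivative D (Suc j) x) (at x)"
    using deriv_chainD[OF assms(1), of j x] Suc.prems at_within_open[OF Suc.prems(2) assms(2)] by simp
  then have "((deriv ^^ j) g has_real_derivative D (Suc j) x) (at x)"
    by (rule has_field_derivative_transform_within_open[OF _ assms(2)]) (use Suc in auto)
  then show ?case by (simp add: DERIV_imp_deriv)
qed (use assms in simp)

text \<open>Classical integration by parts on an interval around the support; \<open>H'\<close> may be unbounded near \<open>c\<close> and
  \<open>d\<close>.\<close>

lemma LINT_deriv_test:
  assumes H: "\<And>x. x \<in> {c<..<d} \<Longrightarrow> (H has_real_derivative H' x) (at x)"
    and H': "continuous_on {c<..<d} H'" and \<phi>: "test_function c d \<phi>"
  shows "(LINT x:{c<..<d}|lebesgue. H x * deriv \<phi> x) = - (LINT x:{c<..<d}|lebesgue. H' x * \<phi> x)"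
proof -
  obtain c' d' where *: "c < c'" "c' < d'" "d' < d" "\<And>x k. x \<notin> {c'<..<d'} \<Longrightarrow> (deriv ^^ k) \<phi> x = 0"
    by (rule test_function_obtain[OF \<phi>]) blast
  have sm: "smooth \<phi>" using \<phi> by (simp add: test_function_iff)
  have cH: "continuous_on {c<..<d} H" using H by (meson DERIV_continuous_on has_field_derivative_at_within)
  have z: "\<phi> x = 0" "deriv \<phi> x = 0" if "x \<notin> {c'<..<d'}" for x
    using *(4)[OF that, of 0] *(4)[OF that, of 1] by simp_all
  have con: "continuous_on S \<phi>" "continuous_on S (deriv \<phi>)" for S
    using smooth_continuous[OF sm, of S 0] smooth_continuous[OF sm, of S 1] by simp_all
  have "{c'..d'} \<subseteq> {c<..<d}" using * by auto
  then have cs: "continuous_on {c'..d'} H" "continuous_on {c'..d'} H'"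
    using cH H' by (auto intro: continuous_on_subset)
  have "((\<lambda>x. H' x * \<phi> x + H x * deriv \<phi> x) has_integral H d' * \<phi> d' - H c' * \<phi> c') {c'..d'}"
  proof (rule fundamental_theorem_of_calculus)
    show "((\<lambda>x. H x * \<phi> x) has_vector_derivative H' x * \<phi> x + H x * deriv \<phi> x) (at x within {c'..d'})"
      if "x \<in> {c'..d'}" for x
    proof -
      have "(H has_real_derivative H' x) (at x within {c'..d'})"
        using H[of x] that * by (auto intro: has_field_derivative_at_within)
      from DERIV_mult[OF this smooth_has_deriv[OF sm, of 0]] show ?thesis
        by (simp add: has_real_derivative_iff_has_vector_derivative mult.commute)
    qed
  qed (use * in simp)
  then have "integral {c'..d'} (\<lambda>x. H' x * \<phi> x + H x * deriv \<phi> x) = 0"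
    using z[of c'] z[of d'] by (simp add: integral_unique)
  moreover have "(\<lambda>x. H' x * \<phi> x) integrable_on {c'..d'}" "(\<lambda>x. H x * deriv \<phi> x) integrable_on {c'..d'}"
    by (intro integrable_continuous_real continuous_intros cs con)+
  ultimately have "integral {c'..d'} (\<lambda>x. H' x * \<phi> x) + integral {c'..d'} (\<lambda>x. H x * deriv \<phi> x) = 0"
    by (simp add: Henstock_Kurzweil_Integration.integral_add)
  then show ?thesis
    using integral_times_test(2)[OF locally_integrable_continuous[OF cH] *(1-3) con(2)]
      integral_times_test(2)[OF locally_integrable_continuous[OF H'] *(1-3) con(1)] z by simp
qed

lemma is_weak_deriv_classical:
  assumes "deriv_chain k {c<..<d} D"
  shows "is_weak_deriv c d k (D 0) (D k)"
proof -
  have "(LINT x:{c<..<d}|lebesgue. D 0 x * (deriv ^^ k) \<phi> x) =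
        (- 1) ^ k * (LINT x:{c<..<d}|lebesgue. D k x * \<phi> x)" if \<phi>: "test_function c d \<phi>" for \<phi>
    using assms
  proof (induction k arbitrary: D)
    case (Suc k)
    have "(LINT x:{c<..<d}|lebesgue. D 0 x * (deriv ^^ Suc k) \<phi> x) =
        - (LINT x:{c<..<d}|lebesgue. D 1 x * (deriv ^^ k) \<phi> x)"
      using LINT_deriv_test[OF _ _ test_function_higher_deriv[OF \<phi>], of "D 0" "D 1" k]
        deriv_chainD[OF Suc.prems, of 0] deriv_chain_continuous[OF Suc.prems, of 1]
      by (simp add: at_within_open[of _ "{c<..<d}"])
    also have "\<dots> = - ((- 1) ^ k * (LINT x:{c<..<d}|lebesgue. D (Suc k) x * \<phi> x))"
      using Suc.IH[OF deriv_chain_shift[OF Suc.prems]] by simp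
    finally show ?case by simp
  qed simp
  then show ?thesis
    unfolding is_weak_deriv_def
    using deriv_chain_continuous[OF assms] by (simp add: locally_integrable_continuous)
qed

lemma is_weak_deriv_cong_AE:
  assumes v: "is_weak_deriv c d k v g" and ae: "AE x in lebesgue_on {c<..<d}. g x = g' x"
  shows "is_weak_deriv c d k v g'"
proof -
  have ae': "AE x in lebesgue_on {l<..<r}. g x = g' x" if "c \<le> l" "r \<le> d" for l r
    using ae that by (auto simp: AE_restrict_space_iff elim!: eventually_mono)
  have li: "locally_integrable c d g" using v by (simp add: is_weak_deriv_def)
  have li': "locally_integrable c d g'"
    unfolding locally_integrable_def
  proof safe
    fix l r assume "c < l" "l \<le> r" "r < d"
    then show "g' absolutely_integrable_on {l..r}"
      using li by (intro absolutely_integrable_cong_AE(1)[OF ae']) (auto simp: locally_integrable_def)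
  qed
  have "(LINT x:{c<..<d}|lebesgue. g' x * \<phi> x) = (LINT x:{c<..<d}|lebesgue. g x * \<phi> x)"
    if "test_function c d \<phi>" for \<phi>
  proof -
    have i: "(\<lambda>x. g x * \<phi> x) absolutely_integrable_on {c..d}"
      using integrable_times_test0[OF li that] by (simp add: absolutely_integrable_on_open_iff)
    have "AE x in lebesgue_on {c<..<d}. g x * \<phi> x = g' x * \<phi> x"
      using ae by eventually_elim simp
    from absolutely_integrable_cong_AE[OF this i] i show ?thesis
      by (simp add: LINT_open_eq_integral)
  qed
  with v li' show ?thesis unfolding is_weak_deriv_def by simp
qed

lemma is_weak_deriv_unique:
  assumes "is_weak_deriv c d k v g" "is_weak_deriv c d k v g'"
  shows "AE x in lebesgue_on {c<..<d}. g x = g' x"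
proof -
  have li: "locally_integrable c d g" "locally_integrable c d g'"
    using assms by (auto simp: is_weak_deriv_def)
  have "AE x in lebesgue_on {c<..<d}. g x - g' x = 0"
  proof (rule fundamental_lemma_calculus_of_variations)
    fix \<phi> assume \<phi>: "test_function c d \<phi>"
    then have "(- 1) ^ k * (LINT x:{c<..<d}|lebesgue. g x * \<phi> x) = (- 1) ^ k * (LINT x:{c<..<d}|lebesgue. g' x * \<phi> x)"
      using assms by (auto simp: is_weak_deriv_def)
    then show "(LINT x:{c<..<d}|lebesgue. (g x - g' x) * \<phi> x) = 0"
      using LINT_diff_test[OF li \<phi>, of 0] by simp
  qed (intro locally_integrable_diff li)
  then show ?thesis by simp
qed

lemma is_weak_deriv_wderiv: "is_weak_deriv c d k v g \<Longrightarrow> is_weak_deriv c d k v (wderiv c d k v)"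
  unfolding wderiv_def by (rule someI[where P = "is_weak_deriv c d k v"])

lemma wderiv_AE: "is_weak_deriv c d k v g \<Longrightarrow> AE x in lebesgue_on {c<..<d}. wderiv c d k v x = g x"
  using is_weak_deriv_unique is_weak_deriv_wderiv by blast

lemma is_weak_deriv_restrict:
  assumes "is_weak_deriv a b k v g" "a \<le> c" "d \<le> b"
  shows "is_weak_deriv c d k v g"
proof -
  have *: "locally_integrable c d h" if "locally_integrable a b h" for h
    using that assms(2,3) unfolding locally_integrable_def by auto
  have "(LINT x:{c<..<d}|lebesgue. h x * (deriv ^^ j) \<phi> x) = (LINT x:{a<..<b}|lebesgue. h x * (deriv ^^ j) \<phi> x)"
    if \<phi>: "test_function c d \<phi>" for \<phi> j h
  proof -
    obtain c' d' where *: "c < c'" "c' < d'" "d' < d" "\<And>x k. x \<notin> {c'<..<d'} \<Longrightarrow> (deriv ^^ k) \<phi> x = 0"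
      by (rule test_function_obtain[OF \<phi>]) blast
    have "indicator {c<..<d} x *\<^sub>R (h x * (deriv ^^ j) \<phi> x) = indicator {a<..<b} x *\<^sub>R (h x * (deriv ^^ j) \<phi> x)" for x
      using * assms(2,3) by (cases "x \<in> {c'<..<d'}") auto
    then show ?thesis unfolding set_lebesgue_integral_def by (simp only:)
  qed
  note eq = this
  have "(LINT x:{c<..<d}|lebesgue. v x * (deriv ^^ k) \<phi> x) = (- 1) ^ k * (LINT x:{c<..<d}|lebesgue. g x * \<phi> x)"
    if \<phi>: "test_function c d \<phi>" for \<phi>
    using assms(1) test_function_mono[OF \<phi> assms(2,3)] eq[OF \<phi>, of v k] eq[OF \<phi>, of g 0]
    unfolding is_weak_deriv_def by simp
  moreover have "locally_integrable a b v" "locally_integrable a b g"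
    using assms(1) unfolding is_weak_deriv_def by blast+
  ultimately show ?thesis
    unfolding is_weak_deriv_def using * by blast
qed

text \<open>A point of disagreement would have a neighbourhood of disagreement in \<open>[c,d]\<close>, and
  intervals of positive length are not null sets.\<close>

lemma continuous_AE_eq:
  fixes r q :: "real \<Rightarrow> real"
  assumes "c < d" "continuous_on {c..d} r" "continuous_on {c..d} q" "AE x in lebesgue_on {c<..<d}. r x = q x" "x \<in> {c..d}"
  shows "r x = q x"
proof (rule ccontr)
  assume neq: "r x \<noteq> q x"
  have "AE x in lebesgue. x \<in> {c<..<d} \<longrightarrow> r x = q x"
    using assms(4) by (simp add: AE_restrict_space_iff)
  then obtain N where N: "N \<in> null_sets lebesgue" "{x. \<not> (x \<in> {c<..<d} \<longrightarrow> r x = q x)} \<subseteq> N"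
    unfolding eventually_ae_filter by auto
  have "continuous_on {c..d} (\<lambda>x. r x - q x)" by (intro continuous_intros assms)
  then have "((\<lambda>x. r x - q x) \<longlongrightarrow> r x - q x) (at x within {c..d})"
    using assms(5) by (auto simp: continuous_on_def)
  then have "eventually (\<lambda>y. r y - q y \<noteq> 0) (at x within {c..d})"
    using neq by (intro tendsto_imp_eventually_ne) auto
  then obtain e where e: "e > 0" "\<And>y. y \<in> {c..d} \<Longrightarrow> y \<noteq> x \<Longrightarrow> dist y x < e \<Longrightarrow> r y - q y \<noteq> 0"
    unfolding eventually_at by blast
  define l where "l = max c (x - e)"
  define u where "u = min d (x + e)"
  have "l < u" using e(1) assms(1,5) by (auto simp: l_def u_def)
  have "{l<..<u} - {x} \<subseteq> N"
    using e(2) N(2) by (force simp: l_def u_def dist_real_def)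
  then have "{l<..<u} \<subseteq> insert x N" by blast
  moreover have "insert x N \<in> null_sets lebesgue"
    using N(1) by (metis negligible_iff_null_sets negligible_insert)
  ultimately have "negligible {l<..<u}"
    by (meson negligible_iff_null_sets negligible_subset)
  then have "negligible (box l u)" by simp
  then show False using \<open>l < u\<close> open_not_negligible[of "box l u"] by simp
qed

text \<open>All continuous representatives agree on the closed interval, so the traces, which are defined by a
  choice, can be read off from any of them.\<close>

lemma cont_rep_eq:
  assumes "c < d" "continuous_on {c..d} r" "AE x in lebesgue_on {c<..<d}. g x = r x" "x \<in> {c..d}"
  shows "cont_rep c d g x = r x"
proof -
  have "continuous_on {c..d} r \<and> (AE x in lebesgue_on {c<..<d}. r x = g x)"
    using assms(2,3) by (auto elim: eventually_mono)
  then have *: "continuous_on {c..d} (cont_rep c d g)" "AE x in lebesgue_on {c<..<d}. cont_rep c d g x = g x"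
    using someI[of "\<lambda>r. continuous_on {c..d} r \<and> (AE x in lebesgue_on {c<..<d}. r x = g x)" r]
    unfolding cont_rep_def by blast+
  have "AE x in lebesgue_on {c<..<d}. cont_rep c d g x = r x"
    using *(2) assms(3) by eventually_elim simp
  with continuous_AE_eq[OF assms(1) *(1) assms(2)] assms(4) show ?thesis by blast
qed

section \<open>The du Bois-Reymond lemma and regularity\<close>

lemma deriv_chain_lincomb:
  assumes "deriv_chain k S D" "deriv_chain k S E"
  shows "deriv_chain k S (\<lambda>j x. D j x + a * E j x)"
  unfolding deriv_chain_def
proof (intro conjI allI impI ballI)
  fix j x assume "j < k" "x \<in> S"
  then show "((\<lambda>x. D j x + a * E j x) has_real_derivative D (Suc j) x + a * E (Suc j) x) (at x within S)"
    by (intro DERIV_add DERIV_cmult deriv_chainD[OF assms(1)] deriv_chainD[OF assms(2)])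
qed (intro continuous_intros deriv_chain_continuous[OF assms(1)] deriv_chain_continuous[OF assms(2)] order_refl)

lemma higher_pderiv_monom_fact: "(pderiv ^^ k) (monom c k) = [:fact k * c:]" for c :: real
proof (induction k arbitrary: c)
  case (Suc k)
  show ?case
    unfolding funpow_Suc_right o_apply pderiv_monom diff_Suc_1 Suc.IH by (simp add: algebra_simps)
qed (simp add: monom_0)

lemma poly_const: "poly [:z:] = (\<lambda>_. z)"
  by (simp add: fun_eq_iff)

text \<open>If all test functions had integral zero, the fundamental lemma would make the constant \<open>1\<close> vanish.\<close>

lemma exists_test_function_integral_1:
  assumes "c < d"
  obtains \<eta> where "test_function c d \<eta>" "(LINT x:{c<..<d}|lebesgue. \<eta> x) = 1"
proof -
  have "\<exists>\<phi>. test_function c d \<phi> \<and> (LINT x:{c<..<d}|lebesgue. \<phi> x) \<noteq> 0"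
  proof (rule ccontr)
    assume "\<not> ?thesis"
    then have "AE x in lebesgue_on {c<..<d}. (1::real) = 0"
      by (intro fundamental_lemma_calculus_of_variations)
        (auto intro: locally_integrable_continuous continuous_intros)
    then show False
      using continuous_AE_eq[OF assms, of "\<lambda>_. 1" "\<lambda>_. 0" c] assms by simp
  qed
  then obtain \<phi> where \<phi>: "test_function c d \<phi>" "(LINT x:{c<..<d}|lebesgue. \<phi> x) \<noteq> 0" by blast
  define I where "I = (LINT x:{c<..<d}|lebesgue. \<phi> x)"
  have "test_function c d (\<lambda>x. (1 / I) * \<phi> x)"
    using \<phi>(1) smooth_mult[OF smooth_const, of \<phi> "1 / I"] unfolding test_function_iff by fastforce
  moreover have "(LINT x:{c<..<d}|lebesgue. (1 / I) * \<phi> x) = 1"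
    using \<phi>(2) by (subst set_integral_mult_right) (simp add: I_def)
  ultimately show ?thesis by (rule that)
qed

text \<open>The antiderivative that vanishes to the left of the support also vanishes to its right, because the
  total integral is zero.\<close>

lemma test_function_antiderivative:
  assumes \<theta>: "test_function c d \<theta>" and 0: "(LINT x:{c<..<d}|lebesgue. \<theta> x) = 0"
  obtains \<phi> where "test_function c d \<phi>" "deriv \<phi> = \<theta>"
proof -
  obtain c' d' where *: "c < c'" "c' < d'" "d' < d" "\<And>x k. x \<notin> {c'<..<d'} \<Longrightarrow> (deriv ^^ k) \<theta> x = 0"
    by (rule test_function_obtain[OF \<theta>]) blast
  have z: "\<theta> x = 0" if "x \<notin> {c'<..<d'}" for x using *(4)[OF that, of 0] by simp
  have sm: "smooth \<theta>" using \<theta> by (simp add: test_function_iff)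
  have con: "continuous_on S \<theta>" for S using smooth_continuous[OF sm, of S 0] by simp
  have tot: "integral {c'..d'} \<theta> = 0"
    using integral_times_test(2)[OF locally_integrable_continuous[of c d "\<lambda>_. 1"] *(1-3) con z] 0 by simp
  \<comment> \<open>For \<open>x < c'\<close> the interval is empty and the integral is \<open>0\<close>, as it should be.\<close>
  define \<phi> where "\<phi> = (\<lambda>x. integral {c'..x} \<theta>)"
  have out: "\<phi> x = 0" if "x \<notin> {c'<..<d'}" for x
  proof (cases "x \<le> c'")
    case True
    then show ?thesis by (cases "x = c'") (auto simp: \<phi>_def)
  next
    case False
    then have x: "d' \<le> x" using that by auto
    have "\<phi> x = integral {c'..d'} \<theta> + integral {d'..x} \<theta>"
      unfolding \<phi>_def using * x
      by (intro Henstock_Kurzweil_Integration.integral_combine[symmetric] integrable_continuous_real con) auto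
    also have "integral {d'..x} \<theta> = 0" using integral_cong[of "{d'..x}" \<theta> "\<lambda>_. 0"] z by force
    finally show ?thesis using tot by simp
  qed
  have der: "(\<phi> has_real_derivative \<theta> x) (at x)" for x
  proof (cases "x > c'")
    case True
    have "(\<phi> has_real_derivative \<theta> x) (at x within {c'..x + 1})"
      unfolding \<phi>_def using True by (intro integral_has_real_derivative con) auto
    then show ?thesis using True by (simp add: at_within_Icc_at)
  next
    case False
    have "(\<phi> has_real_derivative \<theta> x) (at_right x)"
    proof (cases "x = c'")
      case True
      have "(\<phi> has_real_derivative \<theta> x) (at x within {c'..x + 1})"
        unfolding \<phi>_def using True by (intro integral_has_real_derivative con) auto
      then show ?thesis using True by (simp add: at_within_Icc_at_right)
    next
      case F: False
      have "((\<lambda>_. 0) has_real_derivative \<theta> x) (at x)" using F False z by simp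
      then have "(\<phi> has_real_derivative \<theta> x) (at x)"
        by (rule has_field_derivative_transform_within_open[of _ _ _ "{..<c'}"]) (use F False out in auto)
      then show ?thesis by (rule has_field_derivative_at_within)
    qed
    moreover have "(\<phi> has_real_derivative \<theta> x) (at_left x)"
    proof -
      have "((\<lambda>_. 0) has_real_derivative \<theta> x) (at x within {..x})" using False z by simp
      then have "(\<phi> has_real_derivative \<theta> x) (at x within {..x})"
        by (rule has_field_derivative_transform_within[of _ _ _ _ 1]) (use False out in auto)
      then show ?thesis by (rule has_field_derivative_subset) auto
    qed
    ultimately show ?thesis
      by (simp add: has_field_derivative_iff filterlim_split_at)
  qed
  then have deq: "deriv \<phi> = \<theta>" by (auto intro: DERIV_imp_deriv)
  have "smooth \<phi>" unfolding smooth_def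
  proof (intro allI)
    fix k x show "(deriv ^^ k) \<phi> field_differentiable at x"
      using der sm deq unfolding smooth_def
      by (cases k) (auto simp: field_differentiable_def funpow_swap1)
  qed
  moreover have "\<forall>x. x \<notin> {c'..d'} \<longrightarrow> \<phi> x = 0" using out by auto
  ultimately have "test_function c d \<phi>"
    unfolding test_function_iff using * by (meson less_imp_le)
  then show ?thesis using deq by (rule that)
qed

text \<open>Induction on the order; consider the step from \<open>k\<close> to \<open>k + 1\<close>. Every test function \<open>\<psi>\<close> becomes a derivative of a test function after
  subtraction of a multiple of a fixed \<open>\<eta>\<close> of integral \<open>1\<close>. Hence the functional
  \<open>\<psi> \<mapsto> \<integral> h \<psi>\<^bsup>(k)\<^esup>\<close> is a multiple of \<open>\<psi> \<mapsto> \<integral> \<psi>\<close>, and subtracting a monomial of degree \<open>k\<close> from \<open>h\<close> makes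
  it zero.\<close>

lemma du_bois_reymond:
  assumes "c < d" and h: "locally_integrable c d h"
    and z: "\<And>\<phi>. test_function c d \<phi> \<Longrightarrow> (LINT x:{c<..<d}|lebesgue. h x * (deriv ^^ k) \<phi> x) = 0"
  shows "\<exists>q. (pderiv ^^ k) q = 0 \<and> (AE x in lebesgue_on {c<..<d}. h x = poly q x)"
  using h z
proof (induction k arbitrary: h)
  case 0
  then show ?case
    using fundamental_lemma_calculus_of_variations[of c d h] by (intro exI[of _ 0]) simp
next
  case (Suc k)
  obtain \<eta> where \<eta>: "test_function c d \<eta>" "(LINT x:{c<..<d}|lebesgue. \<eta> x) = 1"
    by (rule exists_test_function_integral_1[OF \<open>c < d\<close>])
  define C where "C = (LINT x:{c<..<d}|lebesgue. h x * (deriv ^^ k) \<eta> x)"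
  have eq: "(LINT x:{c<..<d}|lebesgue. h x * (deriv ^^ k) \<psi> x) = C * (LINT x:{c<..<d}|lebesgue. \<psi> x)"
    if \<psi>: "test_function c d \<psi>" for \<psi>
  proof -
    define J where "J = (LINT x:{c<..<d}|lebesgue. \<psi> x)"
    have sm: "smooth \<psi>" "smooth \<eta>" using \<psi> \<eta> by (auto simp: test_function_iff)
    have D: "(deriv ^^ j) (\<lambda>x. \<psi> x - J * \<eta> x) x = (deriv ^^ j) \<psi> x - J * (deriv ^^ j) \<eta> x" for j x
      using deriv_chain_higher_deriv[OF deriv_chain_lincomb[OF smooth_chain[OF sm(1)] smooth_chain[OF sm(2)], of j UNIV "- J"],
          where g = "\<lambda>x. \<psi> x - J * \<eta> x" and j = j and x = x] by simp
    obtain l1 r1 where 1: "c < l1" "l1 < r1" "r1 < d" "\<And>x k. x \<notin> {l1<..<r1} \<Longrightarrow> (deriv ^^ k) \<psi> x = 0"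
      by (rule test_function_obtain[OF \<psi>]) blast
    obtain l2 r2 where 2: "c < l2" "l2 < r2" "r2 < d" "\<And>x k. x \<notin> {l2<..<r2} \<Longrightarrow> (deriv ^^ k) \<eta> x = 0"
      by (rule test_function_obtain[OF \<eta>(1)]) blast
    have \<theta>: "test_function c d (\<lambda>x. \<psi> x - J * \<eta> x)"
      unfolding test_function_iff
    proof (intro conjI exI)
      show "smooth (\<lambda>x. \<psi> x - J * \<eta> x)"
        using smooth_add[OF sm(1) smooth_mult[OF smooth_const sm(2), of "- J"]] by simp
      show "c < min l1 l2" "min l1 l2 \<le> max r1 r2" "max r1 r2 < d" using 1 2 by auto
      show "\<forall>x. x \<notin> {min l1 l2..max r1 r2} \<longrightarrow> \<psi> x - J * \<eta> x = 0"
      proof safe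
        fix x assume "x \<notin> {min l1 l2..max r1 r2}"
        then have "x \<notin> {l1<..<r1}" "x \<notin> {l2<..<r2}" by auto
        then show "\<psi> x - J * \<eta> x = 0" using 1(4)[of x 0] 2(4)[of x 0] by simp
      qed
    qed
    have li1: "locally_integrable c d (\<lambda>_. 1)"
      by (intro locally_integrable_continuous continuous_intros)
    have i: "set_integrable lebesgue {c<..<d} \<psi>" "set_integrable lebesgue {c<..<d} \<eta>"
      using integrable_times_test0[OF li1 \<psi>] integrable_times_test0[OF li1 \<eta>(1)] by simp_all
    have "(LINT x:{c<..<d}|lebesgue. \<psi> x - J * \<eta> x) = 0"
      using i \<eta>(2) by (simp add: set_integral_diff J_def)
    then obtain \<phi> where \<phi>: "test_function c d \<phi>" "deriv \<phi> = (\<lambda>x. \<psi> x - J * \<eta> x)"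
      by (rule test_function_antiderivative[OF \<theta>])
    have "0 = (LINT x:{c<..<d}|lebesgue. h x * (deriv ^^ Suc k) \<phi> x)"
      using Suc.prems(2)[OF \<phi>(1)] by simp
    also have "\<dots> = (LINT x:{c<..<d}|lebesgue. h x * (deriv ^^ k) \<psi> x - J * (h x * (deriv ^^ k) \<eta> x))"
      unfolding funpow_Suc_right o_apply \<phi>(2) D by (simp add: algebra_simps)
    also have "\<dots> = (LINT x:{c<..<d}|lebesgue. h x * (deriv ^^ k) \<psi> x) - J * C"
      using integrable_times_test[OF Suc.prems(1) \<psi>] integrable_times_test[OF Suc.prems(1) \<eta>(1)]
      by (simp add: set_integral_diff C_def)
    finally show ?thesis by (simp add: J_def mult.commute)
  qed
  \<comment> \<open>Its \<open>k\<close>-th derivative is the constant \<open>(-1)\<^sup>k C\<close>, and \<open>k\<close> integrations by parts remove the sign.\<close>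
  define m where "m = monom ((-1) ^ k * C / fact k) k"
  have dm: "(pderiv ^^ k) m = [:(-1) ^ k * C:]"
    by (simp add: m_def higher_pderiv_monom_fact)
  have chain: "deriv_chain k {c<..<d} (\<lambda>j. poly ((pderiv ^^ j) m))"
    unfolding deriv_chain_def by (auto intro: poly_DERIV has_field_derivative_at_within continuous_intros)
  have wd: "is_weak_deriv c d k (poly m) (\<lambda>_. (-1) ^ k * C)"
    using is_weak_deriv_classical[OF chain] by (simp add: dm poly_const)
  have lim: "locally_integrable c d (poly m)" using wd by (simp add: is_weak_deriv_def)
  have "\<exists>q. (pderiv ^^ k) q = 0 \<and> (AE x in lebesgue_on {c<..<d}. h x - poly m x = poly q x)"
  proof (rule Suc.IH)
    show "locally_integrable c d (\<lambda>x. h x - poly m x)"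
      by (intro locally_integrable_diff Suc.prems lim)
    fix \<phi> assume \<phi>: "test_function c d \<phi>"
    have "(LINT x:{c<..<d}|lebesgue. poly m x * (deriv ^^ k) \<phi> x) = C * (LINT x:{c<..<d}|lebesgue. \<phi> x)"
      using wd \<phi> by (simp add: is_weak_deriv_def mult.assoc flip: power_mult_distrib mult.assoc)
    then show "(LINT x:{c<..<d}|lebesgue. (h x - poly m x) * (deriv ^^ k) \<phi> x) = 0"
      using LINT_diff_test[OF Suc.prems(1) lim \<phi>] eq[OF \<phi>] by simp
  qed
  then obtain q where q: "(pderiv ^^ k) q = 0" "AE x in lebesgue_on {c<..<d}. h x - poly m x = poly q x" by blast
  have "(pderiv ^^ Suc k) (q + m) = 0"
    using q(1) dm by (simp add: higher_pderiv_add pderiv_pCons)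
  moreover have "AE x in lebesgue_on {c<..<d}. h x = poly (q + m) x"
    using q(2) by eventually_elim simp
  ultimately show ?case by blast
qed

fun iterated_integral :: "real \<Rightarrow> (real \<Rightarrow> real) \<Rightarrow> nat \<Rightarrow> real \<Rightarrow> real" where
  "iterated_integral c r 0 = r"
| "iterated_integral c r (Suc k) = (\<lambda>x. integral {c..x} (iterated_integral c r k))"

lemma continuous_on_iterated_integral:
  "continuous_on {c..d} r \<Longrightarrow> continuous_on {c..d} (iterated_integral c r k)"
  by (induction k) (auto intro!: indefinite_integral_continuous_1 integrable_continuous_real)

lemma iterated_integral_chain:
  assumes "continuous_on {c..d} r"
  shows "deriv_chain k {c..d} (\<lambda>j. iterated_integral c r (k - j))"
  unfolding deriv_chain_def
proof (intro conjI allI impI ballI)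
  fix j x assume "j < k" "x \<in> {c..d}"
  then show "(iterated_integral c r (k - j) has_real_derivative iterated_integral c r (k - Suc j) x) (at x within {c..d})"
    using integral_has_real_derivative[OF continuous_on_iterated_integral[OF assms], of x "k - Suc j"]
    by (simp add: Suc_diff_Suc flip: iterated_integral.simps(2))
qed (use assms in simp)

text \<open>Regularity: \<open>w\<close> and the \<open>k\<close>-fold antiderivative of \<open>r\<close> have the same weak derivative, so
  they differ by a polynomial annihilated by \<open>k\<close> differentiations. The continuity of \<open>w\<close> turns equality
  almost everywhere into equality up to the boundary.\<close>

lemma weak_deriv_continuous_imp_chain:
  assumes "c < d" and w: "continuous_on {c..d} w" and r: "continuous_on {c..d} r"
    and wd: "is_weak_deriv c d k w r"
  obtains E where "deriv_chain k {c..d} E" "\<And>x. x \<in> {c..d} \<Longrightarrow> E 0 x = w x" "\<And>x. E k x = r x"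
proof -
  let ?K = "\<lambda>j. iterated_integral c r (k - j)"
  have K: "deriv_chain k {c..d} ?K" by (rule iterated_integral_chain[OF r])
  have wK: "is_weak_deriv c d k (?K 0) r"
    using is_weak_deriv_classical[OF deriv_chain_subset[OF K greaterThanLessThan_subseteq_atLeastAtMost_iff[THEN iffD2]]]
    by simp
  have li: "locally_integrable c d w" "locally_integrable c d (?K 0)"
    using wd wK by (auto simp: is_weak_deriv_def)
  have "\<exists>q. (pderiv ^^ k) q = 0 \<and> (AE x in lebesgue_on {c<..<d}. w x - ?K 0 x = poly q x)"
  proof (rule du_bois_reymond[OF \<open>c < d\<close>])
    fix \<phi> assume \<phi>: "test_function c d \<phi>"
    show "(LINT x:{c<..<d}|lebesgue. (w x - ?K 0 x) * (deriv ^^ k) \<phi> x) = 0"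
      using LINT_diff_test[OF li \<phi>] wd wK \<phi> by (simp add: is_weak_deriv_def)
  qed (intro locally_integrable_diff li)
  then obtain q where q: "(pderiv ^^ k) q = 0" "AE x in lebesgue_on {c<..<d}. w x - ?K 0 x = poly q x" by blast
  define E where "E = (\<lambda>j x. ?K j x + poly ((pderiv ^^ j) q) x)"
  show ?thesis
  proof (rule that)
    show "deriv_chain k {c..d} E"
      using K unfolding deriv_chain_def E_def
      by (auto intro!: DERIV_add continuous_intros poly_DERIV[THEN has_field_derivative_at_within])
    show "E k x = r x" for x by (simp add: E_def q(1))
    show "E 0 x = w x" if "x \<in> {c..d}" for x
    proof -
      have "w x - ?K 0 x = poly q x"
        by (rule continuous_AE_eq[OF \<open>c < d\<close> _ _ q(2) that])
          (intro continuous_intros w deriv_chain_continuous[OF K] le0)+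
      then show ?thesis by (simp add: E_def)
    qed
  qed
qed

section \<open>Sobolev functions on one element\<close>

lemma LINT_lebesgue_on_indicator:
  fixes h :: "real \<Rightarrow> real"
  shows "(LINT x|lebesgue_on {c..d}. indicator A x * h x) = (LINT x:{c..d} \<inter> A|lebesgue. h x)"
  by (simp add: integral_restrict_space set_lebesgue_integral_def indicator_inter_arith mult.assoc)

text \<open>Both sides are the iterated integrals of \<open>g x * p' y\<close> over the triangle \<open>x \<le> y\<close>. The function \<open>g\<close> is
  merely integrable, so that the fundamental theorem of calculus applies to \<open>p\<close> but not to the
  indefinite integral of \<open>g\<close>.\<close>

lemma integral_times_indefinite_integral:
  fixes g p p' :: "real \<Rightarrow> real"
  assumes cd: "c \<le> d" and g: "g absolutely_integrable_on {c..d}"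
    and p: "\<And>x. x \<in> {c..d} \<Longrightarrow> (p has_real_derivative p' x) (at x within {c..d})"
    and p': "continuous_on {c..d} p'"
  shows "integral {c..d} (\<lambda>y. integral {c..y} g * p' y) = integral {c..d} (\<lambda>x. g x * (p d - p x))"
proof -
  let ?M = "lebesgue_on {c..d}"
  define f where "f = (\<lambda>x y. g x * (indicator {x..} y * p' y))"
  have fin: "finite_measure ?M" by (rule finite_measure_lebesgue_on) simp
  interpret finite_measure ?M by fact
  interpret pair_sigma_finite ?M ?M ..
  have gi: "integrable ?M g"
    using absolutely_integrable_imp_integrable[OF g] by simp
  have p'i: "integrable ?M p'"
    using absolutely_integrable_imp_integrable[OF absolutely_integrable_continuous_real[OF p']] by simp
  note [measurable] = borel_measurable_integrable[OF gi] borel_measurable_integrable[OF p'i]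
  obtain B where B: "\<And>x. x \<in> {c..d} \<Longrightarrow> \<bar>p' x\<bar> \<le> B"
    using compact_imp_bounded[OF compact_continuous_image[OF p' compact_Icc]]
    unfolding bounded_iff by (metis imageI real_norm_def)
  have dom: "integrable (?M \<Otimes>\<^sub>M ?M) (\<lambda>z. g (fst z) * B)"
  proof (rule Fubini_integrable)
    have "integrable ?M (\<lambda>x. \<bar>g x * B\<bar> * measure ?M (space ?M))"
      using gi by (intro integrable_mult_left integrable_abs)
    then show "integrable ?M (\<lambda>x. LINT y|?M. norm (g (fst (x, y)) * B))"
      by (simp add: mult.commute)
    show "AE x in ?M. integrable ?M (\<lambda>y. g (fst (x, y)) * B)" by simp
  qed measurable
  have [measurable]: "(\<lambda>x. x) \<in> borel_measurable ?M"
    by (rule measurable_restrict_space1) (simp add: id_borel_measurable_lebesgue[unfolded id_def])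
  have [measurable]: "Measurable.pred (?M \<Otimes>\<^sub>M ?M) (\<lambda>z. fst z \<le> snd z)"
    by measurable
  have int: "integrable (?M \<Otimes>\<^sub>M ?M) (case_prod f)"
  proof (rule Bochner_Integration.integrable_bound[OF dom])
    have "case_prod f = (\<lambda>z. g (fst z) * ((if fst z \<le> snd z then 1 else 0) * p' (snd z)))"
      by (auto simp: f_def fun_eq_iff indicator_def)
    also have "\<dots> \<in> borel_measurable (?M \<Otimes>\<^sub>M ?M)" by measurable
    finally show "case_prod f \<in> borel_measurable (?M \<Otimes>\<^sub>M ?M)" .
    show "AE z in ?M \<Otimes>\<^sub>M ?M. norm (case_prod f z) \<le> norm (g (fst z) * B)"
    proof (rule AE_I2)
      fix z assume "z \<in> space (?M \<Otimes>\<^sub>M ?M)"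
      then have "\<bar>p' (snd z)\<bar> \<le> \<bar>B\<bar>" using B[of "snd z"] by (force simp: space_pair_measure)
      then show "norm (case_prod f z) \<le> norm (g (fst z) * B)"
        by (auto simp: f_def case_prod_beta abs_mult indicator_def intro!: mult_left_mono)
    qed
  qed
  have "(LINT y|?M. LINT x|?M. f x y) = (LINT x|?M. LINT y|?M. f x y)"
    by (rule Fubini_integral[OF int])
  moreover have "(LINT y|?M. LINT x|?M. f x y) = integral {c..d} (\<lambda>y. integral {c..y} g * p' y)"
  proof -
    have "(LINT x|?M. f x y) = integral {c..y} g * p' y" if "y \<in> {c..d}" for y
    proof -
      have "(LINT x|?M. f x y) = (LINT x|?M. indicator {..y} x * g x) * p' y"
        by (subst integral_mult_left_zero[symmetric])
          (auto simp: f_def indicator_def simp del: integral_mult_left_zero intro!: Bochner_Integration.integral_cong)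
      also have "{c..d} \<inter> {..y} = {c..y}" using that by auto
      then have "(LINT x|?M. indicator {..y} x * g x) = (LINT x:{c..y}|lebesgue. g x)"
        by (simp only: LINT_lebesgue_on_indicator)
      also have "\<dots> = integral {c..y} g"
        by (rule set_lebesgue_integral_eq_integral(2)) (rule set_integrable_subset[OF g], use that in auto)
      finally show ?thesis .
    qed
    then have "(LINT y|?M. LINT x|?M. f x y) = (LINT y|?M. integral {c..y} g * p' y)"
      by (intro Bochner_Integration.integral_cong) auto
    also have "\<dots> = integral {c..d} (\<lambda>y. integral {c..y} g * p' y)"
    proof (rule lebesgue_integral_eq_integral)
      have "continuous_on {c..d} (\<lambda>y. integral {c..y} g * p' y)"
        by (intro continuous_intros p' indefinite_integral_continuous_1 set_lebesgue_integral_eq_integral(1) g)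
      then show "integrable ?M (\<lambda>y. integral {c..y} g * p' y)"
        by (intro absolutely_integrable_imp_integrable absolutely_integrable_continuous_real) auto
    qed simp
    finally show ?thesis .
  qed
  moreover have "(LINT x|?M. LINT y|?M. f x y) = integral {c..d} (\<lambda>x. g x * (p d - p x))"
  proof -
    have "(LINT y|?M. f x y) = g x * (p d - p x)" if "x \<in> {c..d}" for x
    proof -
      have sub: "{x..d} \<subseteq> {c..d}" using that by auto
      have "(LINT y|?M. f x y) = g x * (LINT y|?M. indicator {x..} y * p' y)"
        by (simp add: f_def)
      also have "{c..d} \<inter> {x..} = {x..d}" using that by auto
      then have "(LINT y|?M. indicator {x..} y * p' y) = (LINT y:{x..d}|lebesgue. p' y)"
        by (simp only: LINT_lebesgue_on_indicator)
      also have "\<dots> = integral {x..d} p'"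
        by (intro set_lebesgue_integral_eq_integral(2) absolutely_integrable_continuous_real
            continuous_on_subset[OF p' sub])
      also have "\<dots> = p d - p x"
      proof (rule integral_unique, rule fundamental_theorem_of_calculus)
        show "(p has_vector_derivative p' y) (at y within {x..d})" if "y \<in> {x..d}" for y
          using has_field_derivative_subset[OF p[of y] sub] that sub
          by (auto simp: has_real_derivative_iff_has_vector_derivative)
      qed (use that in simp)
      finally show ?thesis .
    qed
    then have "(LINT x|?M. LINT y|?M. f x y) = (LINT x|?M. g x * (p d - p x))"
      by (intro Bochner_Integration.integral_cong) auto
    also have "\<dots> = integral {c..d} (\<lambda>x. g x * (p d - p x))"
    proof (rule lebesgue_integral_eq_integral)
      have "continuous_on {c..d} p" using p by (rule DERIV_continuous_on)
      then show "integrable ?M (\<lambda>x. g x * (p d - p x))"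
        by (intro absolutely_integrable_imp_integrable absolutely_integrable_times_continuous(1)[OF g]
            continuous_intros) auto
    qed simp
    finally show ?thesis .
  qed
  ultimately show ?thesis by simp
qed

lemma integration_by_parts_abs_continuous:
  fixes g p p' G :: "real \<Rightarrow> real"
  assumes cd: "c \<le> d" and g: "g absolutely_integrable_on {c..d}"
    and G: "\<And>x. x \<in> {c..d} \<Longrightarrow> G x = G c + integral {c..x} g"
    and p: "\<And>x. x \<in> {c..d} \<Longrightarrow> (p has_real_derivative p' x) (at x within {c..d})"
    and p': "continuous_on {c..d} p'"
  shows "integral {c..d} (\<lambda>x. g x * p x) = G d * p d - G c * p c - integral {c..d} (\<lambda>x. G x * p' x)"
proof -
  have pc: "continuous_on {c..d} p" using p by (rule DERIV_continuous_on)
  have gp: "(\<lambda>x. g x * p x) integrable_on {c..d}" and gi: "g integrable_on {c..d}"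
    using absolutely_integrable_times_continuous(1)[OF g pc] g by (auto dest: set_lebesgue_integral_eq_integral(1))
  have ic: "continuous_on {c..d} (\<lambda>y. integral {c..y} g)"
    by (intro indefinite_integral_continuous_1 gi)
  have ftc: "(p' has_integral p d - p c) {c..d}"
    using p by (intro fundamental_theorem_of_calculus cd) (auto simp: has_real_derivative_iff_has_vector_derivative)
  have "integral {c..d} (\<lambda>x. G x * p' x) = integral {c..d} (\<lambda>x. G c * p' x + integral {c..x} g * p' x)"
    by (intro integral_cong) (simp add: G[symmetric] flip: distrib_right)
  also have "\<dots> = integral {c..d} (\<lambda>x. G c * p' x) + integral {c..d} (\<lambda>x. integral {c..x} g * p' x)"
    by (intro Henstock_Kurzweil_Integration.integral_add integrable_continuous_real continuous_intros p' ic)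
  also have "integral {c..d} (\<lambda>x. G c * p' x) = G c * (p d - p c)"
    using ftc by (simp add: integral_unique)
  also have "integral {c..d} (\<lambda>x. integral {c..x} g * p' x) = integral {c..d} (\<lambda>x. p d * g x - g x * p x)"
    using integral_times_indefinite_integral[OF cd g p p'] by (simp add: algebra_simps)
  also have "\<dots> = p d * integral {c..d} g - integral {c..d} (\<lambda>x. g x * p x)"
    using gp integrable_on_mult_right[OF gi, of "p d"] by (simp add: Henstock_Kurzweil_Integration.integral_diff)
  also have "integral {c..d} g = G d - G c" using G[of d] cd by simp
  finally show ?thesis by (simp add: algebra_simps)
qed

lemma is_weak_deriv_indefinite_integral:
  assumes cd: "c < d" and g: "g absolutely_integrable_on {c..d}"
  shows "is_weak_deriv c d 1 (\<lambda>x. integral {c..x} g) g"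
proof -
  have con: "continuous_on {c..d} (\<lambda>x. integral {c..x} g)"
    by (intro indefinite_integral_continuous_1 set_lebesgue_integral_eq_integral(1) g)
  have "(LINT x:{c<..<d}|lebesgue. integral {c..x} g * deriv \<phi> x) = - (LINT x:{c<..<d}|lebesgue. g x * \<phi> x)"
    if \<phi>: "test_function c d \<phi>" for \<phi>
  proof -
    have sm: "smooth \<phi>" using \<phi> by (simp add: test_function_iff)
    have c\<phi>: "continuous_on {c..d} \<phi>" "continuous_on {c..d} (deriv \<phi>)"
      using smooth_continuous[OF sm, of "{c..d}" 0] smooth_continuous[OF sm, of "{c..d}" 1] by simp_all
    have z: "\<phi> c = 0" "\<phi> d = 0"
      using \<phi> by (auto simp: test_function_def)
    have "integral {c..d} (\<lambda>x. g x * \<phi> x) = - integral {c..d} (\<lambda>x. integral {c..x} g * deriv \<phi> x)"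
      using integration_by_parts_abs_continuous[of c d g "\<lambda>x. integral {c..x} g" \<phi> "deriv \<phi>"]
        smooth_has_deriv[OF sm, of 0] cd g z c\<phi> by simp
    then show ?thesis
      using absolutely_integrable_times_continuous(1)[OF g c\<phi>(1)]
        absolutely_integrable_continuous_real[OF continuous_on_mult[OF con c\<phi>(2)]]
      by (simp add: LINT_open_eq_integral)
  qed
  then show ?thesis
    unfolding is_weak_deriv_def
    using locally_integrable_absolutely[OF g]
      locally_integrable_continuous[OF continuous_on_subset[OF con greaterThanLessThan_subseteq_atLeastAtMost_iff[THEN iffD2]]]
    by auto
qed

text \<open>The difference of \<open>v\<close> and the indefinite integral of \<open>g\<close> has weak derivative zero, hence is constant.\<close>

lemma weak_deriv_abs_continuous:
  assumes cd: "c < d" and g: "g absolutely_integrable_on {c..d}" and wd: "is_weak_deriv c d 1 v g"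
  obtains C where "AE x in lebesgue_on {c<..<d}. v x = C + integral {c..x} g"
proof -
  let ?G = "\<lambda>x. integral {c..x} g"
  have wG: "is_weak_deriv c d 1 ?G g" by (rule is_weak_deriv_indefinite_integral[OF cd g])
  have li: "locally_integrable c d v" "locally_integrable c d ?G"
    using wd wG by (auto simp: is_weak_deriv_def)
  have "\<exists>q. (pderiv ^^ 1) q = 0 \<and> (AE x in lebesgue_on {c<..<d}. v x - ?G x = poly q x)"
  proof (rule du_bois_reymond[OF cd])
    fix \<phi> assume \<phi>: "test_function c d \<phi>"
    show "(LINT x:{c<..<d}|lebesgue. (v x - ?G x) * (deriv ^^ 1) \<phi> x) = 0"
      using LINT_diff_test[OF li \<phi>, of 1] wd wG \<phi> by (simp add: is_weak_deriv_def)
  qed (intro locally_integrable_diff li)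
  then obtain q where q: "pderiv q = 0" "AE x in lebesgue_on {c<..<d}. v x - ?G x = poly q x" by auto
  from q(1) obtain C where "q = [:C:]" by (auto simp: pderiv_eq_0_iff elim: degree_eq_zeroE)
  then have "AE x in lebesgue_on {c<..<d}. v x = C + ?G x"
    using q(2) by (auto elim: eventually_mono)
  then show ?thesis by (rule that)
qed

lemma is_weak_deriv_step:
  assumes "is_weak_deriv c d 1 v v1" "is_weak_deriv c d (Suc k) v g"
  shows "is_weak_deriv c d k v1 g"
proof -
  have "(LINT x:{c<..<d}|lebesgue. v1 x * (deriv ^^ k) \<phi> x) = (- 1) ^ k * (LINT x:{c<..<d}|lebesgue. g x * \<phi> x)"
    if \<phi>: "test_function c d \<phi>" for \<phi>
  proof -
    have "(LINT x:{c<..<d}|lebesgue. v x * (deriv ^^ 1) ((deriv ^^ k) \<phi>) x) = - (LINT x:{c<..<d}|lebesgue. v1 x * (deriv ^^ k) \<phi> x)"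
      using assms(1) test_function_higher_deriv[OF \<phi>] by (simp add: is_weak_deriv_def)
    moreover have "(LINT x:{c<..<d}|lebesgue. v x * (deriv ^^ Suc k) \<phi> x) = (- 1) ^ Suc k * (LINT x:{c<..<d}|lebesgue. g x * \<phi> x)"
      using assms(2) \<phi> unfolding is_weak_deriv_def by blast
    ultimately show ?thesis by simp
  qed
  then show ?thesis using assms by (simp add: is_weak_deriv_def)
qed

text \<open>The hypothesis on \<open>g\<close> is an identity between integrals against test functions, the form in which
  the weak formulation delivers the equation for the second derivative.\<close>

lemma is_weak_deriv_trans:
  assumes "is_weak_deriv c d j v g" 
    and "locally_integrable c d r" 
    and "\<And>\<phi>. test_function c d \<phi> \<Longrightarrow> (LINT x:{c<..<d}|lebesgue. g x * (deriv ^^ k) \<phi> x) = (- 1) ^ k * (LINT x:{c<..<d}|lebesgue. r x * \<phi> x)"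
  shows "is_weak_deriv c d (j + k) v r"
proof -
  have "(LINT x:{c<..<d}|lebesgue. v x * (deriv ^^ (j + k)) \<phi> x) = (- 1) ^ (j + k) * (LINT x:{c<..<d}|lebesgue. r x * \<phi> x)"
    if \<phi>: "test_function c d \<phi>" for \<phi>
    using assms(1,3) \<phi> test_function_higher_deriv[OF \<phi>, of k] by (simp add: is_weak_deriv_def funpow_add power_add)
  with assms show ?thesis by (simp add: is_weak_deriv_def)
qed

lemma L2_absolutely_integrable:
  assumes "v \<in> L2 c d" shows "v absolutely_integrable_on {c..d}"
proof -
  have m: "v \<in> borel_measurable (lebesgue_on {c<..<d})" and i: "integrable (lebesgue_on {c<..<d}) (\<lambda>x. (v x)\<^sup>2)"
    using assms by (auto simp: L2_def)
  interpret finite_measure "lebesgue_on {c<..<d}"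
    by (rule finite_measure_lebesgue_on) simp
  have "integrable (lebesgue_on {c<..<d}) v"
  proof (rule Bochner_Integration.integrable_bound[OF _ m])
    show "integrable (lebesgue_on {c<..<d}) (\<lambda>x. 1 + (v x)\<^sup>2)" using i by simp
    have "\<bar>z\<bar> \<le> 1 + z\<^sup>2" for z :: real
      using zero_le_power2[of "\<bar>z\<bar> - 1"] by (simp add: power2_eq_square algebra_simps)
    then show "AE x in lebesgue_on {c<..<d}. norm (v x) \<le> norm (1 + (v x)\<^sup>2)"
      by (intro AE_I2) simp
  qed
  then have "v absolutely_integrable_on {c<..<d}"
    by (simp add: set_integrable_def integrable_restrict_space)
  then show ?thesis by (simp add: absolutely_integrable_on_open_iff)
qed

text \<open>The weak first derivative of \<open>v\<close> has the weak derivative \<open>g\<close> and is therefore an indefinite integral;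
  \<open>v\<close> itself is then an indefinite integral of a continuous function.\<close>

lemma sobolev_2_structure:
  assumes cd: "c < d" and v: "v \<in> sobolev s c d" and s: "s \<ge> 2"
  obtains V0 V1 g where
    "g absolutely_integrable_on {c..d}"
    "\<And>x. x \<in> {c..d} \<Longrightarrow> V1 x = V1 c + integral {c..x} g"
    "\<And>x. x \<in> {c..d} \<Longrightarrow> V0 x = V0 c + integral {c..x} V1"
    "continuous_on {c..d} V1" "continuous_on {c..d} V0"
    "AE x in lebesgue_on {c<..<d}. v x = V0 x"
    "AE x in lebesgue_on {c<..<d}. wderiv c d 0 v x = V0 x"
    "AE x in lebesgue_on {c<..<d}. wderiv c d 1 v x = V1 x"
    "AE x in lebesgue_on {c<..<d}. wderiv c d 2 v x = g x"
proof -
  have "1 \<le> nat \<lfloor>s\<rfloor>" "2 \<le> nat \<lfloor>s\<rfloor>" using s by linarith+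
  then obtain g1 g where g1: "is_weak_deriv c d 1 v g1" and g: "g \<in> L2 c d" "is_weak_deriv c d 2 v g"
    using v unfolding sobolev_def by blast
  have gi: "g absolutely_integrable_on {c..d}" by (rule L2_absolutely_integrable[OF g(1)])
  have "is_weak_deriv c d 1 g1 g"
    using is_weak_deriv_step[OF g1, of 1] g(2) by (simp add: numeral_2_eq_2)
  then obtain C1 where C1: "AE x in lebesgue_on {c<..<d}. g1 x = C1 + integral {c..x} g"
    by (rule weak_deriv_abs_continuous[OF cd gi])
  define V1 where "V1 = (\<lambda>x. C1 + integral {c..x} g)"
  have V1c: "continuous_on {c..d} V1"
    unfolding V1_def
    by (intro continuous_intros indefinite_integral_continuous_1 set_lebesgue_integral_eq_integral(1) gi)
  have wV1: "is_weak_deriv c d 1 v V1"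
    using is_weak_deriv_cong_AE[OF g1 C1] by (simp add: V1_def)
  obtain C0 where C0: "AE x in lebesgue_on {c<..<d}. v x = C0 + integral {c..x} V1"
    by (rule weak_deriv_abs_continuous[OF cd absolutely_integrable_continuous_real[OF V1c] wV1])
  define V0 where "V0 = (\<lambda>x. C0 + integral {c..x} V1)"
  have w0: "is_weak_deriv c d 0 v v"
    using g1 by (simp add: is_weak_deriv_def)
  show ?thesis
  proof (rule that[of g V1 V0])
    show "continuous_on {c..d} V0"
      unfolding V0_def by (intro continuous_intros indefinite_integral_continuous_1 integrable_continuous_real V1c)
    show v0: "AE x in lebesgue_on {c<..<d}. v x = V0 x" using C0 by (simp add: V0_def)
    show "AE x in lebesgue_on {c<..<d}. wderiv c d 0 v x = V0 x"
      using wderiv_AE[OF w0] v0 by eventually_elim simp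
  qed (use gi V1c wderiv_AE[OF wV1] wderiv_AE[OF g(2)] in \<open>auto simp: V1_def V0_def\<close>)
qed

text \<open>Two integrations by parts. The traces of \<open>v\<close> are the end values of the absolutely continuous
  representatives of \<open>v\<close> and of its first derivative.\<close>

lemma sobolev_element_green:
  assumes cd: "c < d" and v: "v \<in> sobolev s c d" and s: "s \<ge> 2"
    and E: "deriv_chain 4 {c..d} E"
    and w2: "AE x in lebesgue_on {c<..<d}. w2 x = E 2 x"
  shows "(LINT x:{c<..<d}|lebesgue. w2 x * wderiv c d 2 v x) =
     (E 2 d * cont_rep c d (wderiv c d 1 v) d - E 2 c * cont_rep c d (wderiv c d 1 v) c)
     - (E 3 d * cont_rep c d (wderiv c d 0 v) d - E 3 c * cont_rep c d (wderiv c d 0 v) c)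
     + integral {c..d} (\<lambda>x. E 4 x * v x)"
proof -
  obtain V0 V1 g where
    g: "g absolutely_integrable_on {c..d}" and
    V1: "\<And>x. x \<in> {c..d} \<Longrightarrow> V1 x = V1 c + integral {c..x} g" and
    V0: "\<And>x. x \<in> {c..d} \<Longrightarrow> V0 x = V0 c + integral {c..x} V1" and
    con: "continuous_on {c..d} V1" "continuous_on {c..d} V0" and
    ae: "AE x in lebesgue_on {c<..<d}. v x = V0 x"
    "AE x in lebesgue_on {c<..<d}. wderiv c d 0 v x = V0 x"
    "AE x in lebesgue_on {c<..<d}. wderiv c d 1 v x = V1 x"
    "AE x in lebesgue_on {c<..<d}. wderiv c d 2 v x = g x"
    by (rule sobolev_2_structure[OF cd v s]) blast
  have tr: "cont_rep c d (wderiv c d 0 v) x = V0 x" "cont_rep c d (wderiv c d 1 v) x = V1 x" if "x \<in> {c..d}" for x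
    using cont_rep_eq[OF cd con(2) ae(2) that] cont_rep_eq[OF cd con(1) ae(3) that] by auto
  have ends: "c \<in> {c..d}" "d \<in> {c..d}" using cd by auto
  have E': "(E 2 has_real_derivative E 3 x) (at x within {c..d})" "(E 3 has_real_derivative E 4 x) (at x within {c..d})"
    if "x \<in> {c..d}" for x
    using deriv_chainD[OF E, of 2 x] deriv_chainD[OF E, of 3 x] that by (simp_all add: eval_nat_numeral)
  have Ec: "continuous_on {c..d} (E 2)" "continuous_on {c..d} (E 3)" "continuous_on {c..d} (E 4)"
    using deriv_chain_continuous[OF E] by simp_all
  have i2: "(\<lambda>x. g x * E 2 x) absolutely_integrable_on {c..d}"
    by (rule absolutely_integrable_times_continuous(1)[OF g Ec(1)])
  have "AE x in lebesgue_on {c<..<d}. g x * E 2 x = w2 x * wderiv c d 2 v x"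
    using w2 ae(4) by eventually_elim simp
  from absolutely_integrable_cong_AE[OF this i2]
  have "(LINT x:{c<..<d}|lebesgue. w2 x * wderiv c d 2 v x) = integral {c..d} (\<lambda>x. g x * E 2 x)"
    by (simp add: LINT_open_eq_integral)
  also have "\<dots> = V1 d * E 2 d - V1 c * E 2 c - integral {c..d} (\<lambda>x. V1 x * E 3 x)"
    using cd by (intro integration_by_parts_abs_continuous g V1 E' Ec) auto
  also have "integral {c..d} (\<lambda>x. V1 x * E 3 x) = V0 d * E 3 d - V0 c * E 3 c - integral {c..d} (\<lambda>x. V0 x * E 4 x)"
    using cd by (intro integration_by_parts_abs_continuous absolutely_integrable_continuous_real con V0 E' Ec) auto
  also have "integral {c..d} (\<lambda>x. V0 x * E 4 x) = integral {c..d} (\<lambda>x. E 4 x * v x)"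
  proof (rule absolutely_integrable_cong_AE(2)[symmetric])
    show "AE x in lebesgue_on {c<..<d}. V0 x * E 4 x = E 4 x * v x"
      using ae(1) by eventually_elim simp
    show "(\<lambda>x. V0 x * E 4 x) absolutely_integrable_on {c..d}"
      by (intro absolutely_integrable_continuous_real continuous_intros con Ec)
  qed
  finally show ?thesis using tr ends by (simp add: algebra_simps)
qed

section \<open>Smooth functions belong to every Sobolev space\<close>

lemma nn_integral_abs_powr_finite:
  fixes q R :: real
  assumes "q > - 1" "R \<ge> 0"
  shows "(\<integral>\<^sup>+z. ennreal (indicator {-R..R} z * \<bar>z\<bar> powr q) \<partial>lebesgue) < \<infinity>"
proof -
  define h where "h = (\<lambda>z. ennreal (indicator {0..R} z * z powr q))"
  have hm: "h \<in> borel_measurable borel" unfolding h_def by measurable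
  have hml: "h \<in> borel_measurable lebesgue" "(\<lambda>z. h (- z)) \<in> borel_measurable lebesgue"
    using hm by (auto intro!: measurable_completion simp: measurable_lborel1)
  have "integral\<^sup>N lborel h < \<infinity>"
    using nn_integral_has_integral_lebesgue[OF _ has_integral_powr_from_0[OF assms]] unfolding h_def by simp
  then have h: "integral\<^sup>N lebesgue h < \<infinity>"
    using hm by (simp add: nn_integral_completion)
  have h': "(\<integral>\<^sup>+z. h (- z) \<partial>lebesgue) = integral\<^sup>N lebesgue h"
    using nn_integral_real_affine_lebesgue[OF hml(1), of "-1" 0] by simp
  have "(\<integral>\<^sup>+z. ennreal (indicator {-R..R} z * \<bar>z\<bar> powr q) \<partial>lebesgue) \<le> (\<integral>\<^sup>+z. h z + h (- z) \<partial>lebesgue)"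
    by (intro nn_integral_mono) (auto simp: h_def indicator_def)
  also have "\<dots> = integral\<^sup>N lebesgue h + integral\<^sup>N lebesgue h"
    using hml h' by (simp add: nn_integral_add)
  also have "\<dots> < \<infinity>" using h by (simp add: ennreal_add_eq_top less_top)
  finally show ?thesis .
qed

text \<open>For a Lipschitz function the integrand is at most \<open>L\<^sup>2 |x - y| powr (1 - 2 * \<theta>)\<close>. Its singularity on
  the diagonal is integrable because \<open>1 - 2 * \<theta> > - 1\<close>.\<close>

lemma gagliardo_lipschitz_finite:
  assumes "c < d" "\<theta> < 1" "L \<ge> 0"
    and L: "\<And>x y. x \<in> {c<..<d} \<Longrightarrow> y \<in> {c<..<d} \<Longrightarrow> \<bar>g x - g y\<bar> \<le> L * \<bar>x - y\<bar>"
  shows "gagliardo \<theta> c d g < \<infinity>"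
proof -
  \<comment> \<open>The exponent of \<open>|x - y|\<close> that remains after the Lipschitz bound.\<close>
  define q where "q = 1 - 2 * \<theta>"
  define h where "h = (\<lambda>z. ennreal (indicator {-(d - c)..d - c} z * \<bar>z\<bar> powr q))"
  define I where "I = integral\<^sup>N lebesgue h"
  have hm: "h \<in> borel_measurable lebesgue"
    unfolding h_def by (intro measurable_completion) (simp add: measurable_lborel1)
  have I: "I < \<infinity>"
    unfolding I_def h_def using assms by (intro nn_integral_abs_powr_finite) (auto simp: q_def)
  have pt: "(g x - g y)\<^sup>2 / \<bar>x - y\<bar> powr (1 + 2 * \<theta>) \<le> L\<^sup>2 * \<bar>x - y\<bar> powr q"
    if "x \<in> {c<..<d}" "y \<in> {c<..<d}" for x y
  proof (cases "x = y")
    case False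
    then have pos: "\<bar>x - y\<bar> > 0" by simp
    have "(g x - g y)\<^sup>2 \<le> (L * \<bar>x - y\<bar>)\<^sup>2"
      using power_mono[OF L[OF that], of 2] by simp
    also have "\<dots> = L\<^sup>2 * \<bar>x - y\<bar> powr 2"
      using pos by (simp add: power_mult_distrib powr_numeral)
    also have "\<bar>x - y\<bar> powr 2 = \<bar>x - y\<bar> powr q * \<bar>x - y\<bar> powr (1 + 2 * \<theta>)"
      by (simp add: q_def flip: powr_add)
    finally show ?thesis using pos by (simp add: field_simps)
  qed simp
  have inner: "(\<integral>\<^sup>+y. ennreal ((g x - g y)\<^sup>2 / \<bar>x - y\<bar> powr (1 + 2 * \<theta>)) \<partial>lebesgue_on {c<..<d}) \<le> ennreal (L\<^sup>2) * I"
    if x: "x \<in> {c<..<d}" for x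
  proof -
    have "(\<integral>\<^sup>+y. ennreal ((g x - g y)\<^sup>2 / \<bar>x - y\<bar> powr (1 + 2 * \<theta>)) \<partial>lebesgue_on {c<..<d})
        \<le> (\<integral>\<^sup>+y. ennreal (L\<^sup>2) * h (x - y) \<partial>lebesgue)"
      by (subst nn_integral_restrict_space)
        (use pt[OF x] x in \<open>auto simp: h_def indicator_def simp flip: ennreal_mult intro!: nn_integral_mono ennreal_leI\<close>)
    also have "\<dots> = ennreal (L\<^sup>2) * (\<integral>\<^sup>+y. h (x - y) \<partial>lebesgue)"
    proof (rule nn_integral_cmult)
      have "(\<lambda>y. h (x - y)) \<in> borel_measurable borel" unfolding h_def by measurable
      then show "(\<lambda>y. h (x - y)) \<in> borel_measurable lebesgue"
        by (intro measurable_completion) (simp add: measurable_lborel1)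
    qed
    also have "(\<integral>\<^sup>+y. h (x - y) \<partial>lebesgue) = I"
      using nn_integral_real_affine_lebesgue[OF hm, of "-1" x] by (simp add: I_def)
    finally show ?thesis .
  qed
  have "gagliardo \<theta> c d g \<le> (\<integral>\<^sup>+x. ennreal (L\<^sup>2) * I \<partial>lebesgue_on {c<..<d})"
    unfolding gagliardo_def by (intro nn_integral_mono inner) simp
  also have "\<dots> = ennreal (L\<^sup>2) * I * ennreal (d - c)"
    using assms by (simp add: emeasure_restrict_space)
  also have "\<dots> < \<infinity>" using I by (simp add: ennreal_mult_less_top)
  finally show ?thesis .
qed

lemma continuous_L2:
  assumes "continuous_on {c..d} v" shows "v \<in> L2 c d"
proof -
  have i: "h \<in> borel_measurable (lebesgue_on {c<..<d})" "integrable (lebesgue_on {c<..<d}) h"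
    if "continuous_on {c..d} h" for h :: "real \<Rightarrow> real"
  proof -
    show "integrable (lebesgue_on {c<..<d}) h"
      using absolutely_integrable_continuous_real[OF that]
      by (intro absolutely_integrable_imp_integrable) (simp_all add: absolutely_integrable_on_open_iff)
    then show "h \<in> borel_measurable (lebesgue_on {c<..<d})" by auto
  qed
  show ?thesis unfolding L2_def using i(1)[OF assms] i(2)[of "\<lambda>x. (v x)\<^sup>2"] assms
    by (auto intro: continuous_intros)
qed

lemma smooth_in_sobolev:
  assumes "c < d" "smooth v"
  shows "v \<in> sobolev s c d"
proof -
  have L2: "(deriv ^^ j) v \<in> L2 c d" for j
    by (intro continuous_L2 smooth_continuous assms)
  have wd: "is_weak_deriv c d j v ((deriv ^^ j) v)" for j
    using is_weak_deriv_classical[OF smooth_chain[OF assms(2)], of c d j] by simp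
  have "gagliardo (frac s) c d ((deriv ^^ j) v) < \<infinity>" for j
  proof -
    have "bounded ((deriv ^^ Suc j) v ` {c..d})"
      by (intro compact_imp_bounded compact_continuous_image smooth_continuous assms) auto
    then obtain L where L: "\<And>x. x \<in> {c..d} \<Longrightarrow> \<bar>(deriv ^^ Suc j) v x\<bar> \<le> L"
      unfolding bounded_iff by (metis imageI real_norm_def)
    have "L \<ge> 0" using L[of c] assms(1) by force
    show ?thesis
    proof (rule gagliardo_lipschitz_finite[OF assms(1) frac_lt_1 \<open>L \<ge> 0\<close>])
      fix x y assume "x \<in> {c<..<d}" "y \<in> {c<..<d}"
      then have "norm ((deriv ^^ j) v x - (deriv ^^ j) v y) \<le> L * norm (x - y)"
        using L by (intro field_differentiable_bound[of "{c..d}" _ "(deriv ^^ Suc j) v"] smooth_has_deriv assms)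
          auto
      then show "\<bar>(deriv ^^ j) v x - (deriv ^^ j) v y\<bar> \<le> L * \<bar>x - y\<bar>" by simp
    qed
  qed
  then show ?thesis unfolding sobolev_def using L2[of 0] L2 wd by auto
qed

section \<open>Green's formula on the mesh\<close>

lemma mesh_mono:
  assumes "mesh a b N X" "m \<le> n" "n \<le> N" shows "X m \<le> X n"
  using assms(2,3)
proof (induction n rule: dec_induct)
  case (step n)
  then have "X n < X (Suc n)" using assms(1) by (simp add: mesh_def)
  with step show ?case by simp
qed simp

lemma mesh_bounds:
  assumes "mesh a b N X" "n \<le> N" shows "a \<le> X n" "X n \<le> b"
  using mesh_mono[OF assms(1), of 0 n] mesh_mono[OF assms(1), of n N] assms by (auto simp: mesh_def)

lemma mesh_element:
  assumes "mesh a b N X" "n < N" shows "X n < X (Suc n)" "a \<le> X n" "X (Suc n) \<le> b"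
  using assms mesh_bounds[OF assms(1), of n] mesh_bounds[OF assms(1), of "Suc n"] by (auto simp: mesh_def)

lemma mesh_pos: "mesh a b N X \<Longrightarrow> a < b \<Longrightarrow> N > 0"
  by (cases N) (auto simp: mesh_def)

lemma integral_mesh:
  fixes h :: "real \<Rightarrow> real"
  assumes "mesh a b N X" "h integrable_on {a..b}"
  shows "integral {a..b} h = (\<Sum>n<N. integral {X n..X (Suc n)} h)"
proof -
  have "integral {X 0..X M} h = (\<Sum>n<M. integral {X n..X (Suc n)} h)" if "M \<le> N" for M
    using that
  proof (induction M)
    case (Suc M)
    have "integral {X 0..X M} h + integral {X M..X (Suc M)} h = integral {X 0..X (Suc M)} h"
    proof (rule Henstock_Kurzweil_Integration.integral_combine)
      show "X 0 \<le> X M" "X M \<le> X (Suc M)" using Suc.prems by (auto intro!: mesh_mono[OF assms(1)])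
      show "h integrable_on {X 0..X (Suc M)}"
        using mesh_bounds[OF assms(1), of "Suc M"] Suc.prems assms
        by (auto simp: mesh_def intro: integrable_on_subinterval)
    qed
    then show ?case using Suc by simp
  qed simp
  from this[of N] show ?thesis using assms(1) by (simp add: mesh_def)
qed

text \<open>Summation by nodes instead of elements; \<open>m\<close> and \<open>q\<close> are the left and right traces of a
  piecewise function and \<open>P\<close> is continuous.\<close>

lemma sum_element_ends_eq_sum_jumps:
  fixes P m q :: "nat \<Rightarrow> real"
  assumes "N > 0"
  shows "(\<Sum>n<N. P (Suc n) * m (Suc n) - P n * q n) =
    (\<Sum>n\<le>N. P n * (if n = 0 then - q n else if n = N then m n else m n - q n))"
proof -
  have "(\<Sum>n\<le>N. P n * (if n = 0 then - q n else if n = N then m n else m n - q n)) =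
      (\<Sum>n\<le>N. (if n = 0 then 0 else P n * m n)) - (\<Sum>n\<le>N. (if n = N then 0 else P n * q n))"
    using assms by (subst sum_subtractf[symmetric]) (intro sum.cong, auto simp: algebra_simps)
  also have "(\<Sum>n\<le>N. (if n = 0 then 0 else P n * m n)) = (\<Sum>n<N. P (Suc n) * m (Suc n))"
    by (subst sum.atMost_shift) simp
  also have "(\<Sum>n\<le>N. (if n = N then 0 else P n * q n)) = (\<Sum>n<N. P n * q n)"
    by (simp add: lessThan_Suc_atMost[symmetric])
  finally show ?thesis by (simp add: sum_subtractf)
qed

lemma is_weak_deriv_cong:
  assumes "is_weak_deriv c d k v g" and eq: "\<And>x. x \<in> {c<..<d} \<Longrightarrow> v x = v' x"
  shows "is_weak_deriv c d k v' g"
proof -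
  have "v' absolutely_integrable_on {l..r}" if "c < l" "l \<le> r" "r < d" for l r
  proof -
    have "v absolutely_integrable_on {l..r}"
      using assms(1) that by (simp add: is_weak_deriv_def locally_integrable_def)
    then show ?thesis
      by (rule absolutely_integrable_spike[of _ _ "{}"]) (use eq that in auto)
  qed
  moreover have "(LINT x:{c<..<d}|lebesgue. v' x * (deriv ^^ k) \<phi> x) = (LINT x:{c<..<d}|lebesgue. v x * (deriv ^^ k) \<phi> x)" for \<phi>
    by (intro set_lebesgue_integral_cong) (auto simp: eq)
  ultimately show ?thesis using assms(1) by (simp add: is_weak_deriv_def locally_integrable_def)
qed

lemma deriv_chain_continuous_0:
  assumes "deriv_chain k S E" "\<And>x. x \<in> S \<Longrightarrow> E 0 x = w x"
  shows "continuous_on S w"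
  using deriv_chain_continuous[OF assms(1), of 0] continuous_on_cong[of S S "E 0" w] assms(2) by auto

lemma chain_is_weak_deriv:
  assumes "deriv_chain k {a..b} E" "\<And>x. x \<in> {a..b} \<Longrightarrow> E 0 x = w x" "j \<le> k" "a \<le> c" "d \<le> b"
  shows "is_weak_deriv c d j w (E j)"
proof (rule is_weak_deriv_cong)
  have "{c<..<d} \<subseteq> {a..b}" using assms by auto
  then show "is_weak_deriv c d j (E 0) (E j)"
    by (intro is_weak_deriv_classical deriv_chain_subset[OF deriv_chain_le[OF assms(1,3)]])
qed (use assms in auto)

lemma chain_traces:
  assumes X: "mesh a b N X"
    and E: "deriv_chain k {a..b} E" "\<And>x. x \<in> {a..b} \<Longrightarrow> E 0 x = w x" "j \<le> k"
  shows "n < N \<Longrightarrow> trace_plus X j w n = E j (X n)"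
    and "0 < n \<Longrightarrow> n \<le> N \<Longrightarrow> trace_minus X j w n = E j (X n)"
proof -
  have *: "cont_rep (X n) (X (Suc n)) (wderiv (X n) (X (Suc n)) j w) x = E j x"
    if "n < N" "x \<in> {X n..X (Suc n)}" for n x
  proof (rule cont_rep_eq[OF mesh_element(1)[OF X that(1)] _ _ that(2)])
    show "continuous_on {X n..X (Suc n)} (E j)"
      using deriv_chain_continuous[OF E(1,3)] mesh_element[OF X that(1)] by (auto intro: continuous_on_subset)
    show "AE x in lebesgue_on {X n<..<X (Suc n)}. wderiv (X n) (X (Suc n)) j w x = E j x"
      using mesh_element[OF X that(1)] by (intro wderiv_AE chain_is_weak_deriv[OF E])
  qed
  show "trace_plus X j w n = E j (X n)" if "n < N"
    using *[of n "X n"] that mesh_element[OF X that] by (simp add: trace_plus_def)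
  show "trace_minus X j w n = E j (X n)" if "0 < n" "n \<le> N"
    using *[of "n - 1" "X n"] that mesh_element(1)[OF X, of "n - 1"]
    by (simp add: trace_minus_def order_less_imp_le)
qed

text \<open>A function that is continuously differentiable on \<open>[a,b]\<close> jumps only at the two ends, where the
  convention of the jump is a one-sided trace.\<close>

lemma chain_jump_average:
  assumes X: "mesh a b N X" and "a < b"
    and E: "deriv_chain k {a..b} E" "\<And>x. x \<in> {a..b} \<Longrightarrow> E 0 x = w x" "j \<le> k" and "n \<le> N"
  shows "jump N X j w n = (if n = 0 then - E j a else if n = N then E j b else 0)"
    and "average N X j w n = E j (X n)"
proof -
  have "N > 0" by (rule mesh_pos[OF X \<open>a < b\<close>])
  moreover have "X 0 = a" "X N = b" using X by (auto simp: mesh_def)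
  ultimately show "jump N X j w n = (if n = 0 then - E j a else if n = N then E j b else 0)"
    "average N X j w n = E j (X n)"
    using chain_traces[OF X E, of n] \<open>n \<le> N\<close> by (auto simp: jump_def average_def)
qed

text \<open>Summing Green's formula over the elements produces exactly the two consistency terms of the bilinear
  form, with the averages of \<open>w\<close> equal to its nodal values.\<close>

lemma broken_green:
  assumes X: "mesh a b N X" and "a < b" and v: "v \<in> broken_sobolev s N X" and s: "s \<ge> 2"
    and E: "deriv_chain 4 {a..b} E" "\<And>x. x \<in> {a..b} \<Longrightarrow> E 0 x = w x"
  shows "(\<Sum>n<N. LINT x:{X n<..<X (Suc n)}|lebesgue.
        wderiv (X n) (X (Suc n)) 2 w x * wderiv (X n) (X (Suc n)) 2 v x)
     + (\<Sum>n\<le>N. average N X 3 w n * jump N X 0 v n) - (\<Sum>n\<le>N. average N X 2 w n * jump N X 1 v n)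
     = integral {a..b} (\<lambda>x. E 4 x * v x)"
proof -
  have N: "N > 0" by (rule mesh_pos[OF X \<open>a < b\<close>])
  have vi: "v absolutely_integrable_on {a..b}"
    using v X by (auto simp: broken_sobolev_def mesh_def intro: L2_absolutely_integrable)
  have tm: "cont_rep (X n) (X (Suc n)) (wderiv (X n) (X (Suc n)) j v) (X (Suc n)) = trace_minus X j v (Suc n)"
    and tp: "cont_rep (X n) (X (Suc n)) (wderiv (X n) (X (Suc n)) j v) (X n) = trace_plus X j v n" for n j
    by (simp_all add: trace_minus_def trace_plus_def)
  have "(LINT x:{X n<..<X (Suc n)}|lebesgue. wderiv (X n) (X (Suc n)) 2 w x * wderiv (X n) (X (Suc n)) 2 v x) =
      (E 2 (X (Suc n)) * trace_minus X 1 v (Suc n) - E 2 (X n) * trace_plus X 1 v n)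
      - (E 3 (X (Suc n)) * trace_minus X 0 v (Suc n) - E 3 (X n) * trace_plus X 0 v n)
      + integral {X n..X (Suc n)} (\<lambda>x. E 4 x * v x)" if n: "n < N" for n
  proof -
    note el = mesh_element[OF X n]
    have "v \<in> sobolev s (X n) (X (Suc n))" using v n by (simp add: broken_sobolev_def)
    moreover have "deriv_chain 4 {X n..X (Suc n)} E"
      using el by (intro deriv_chain_subset[OF E(1)]) auto
    moreover have "AE x in lebesgue_on {X n<..<X (Suc n)}. wderiv (X n) (X (Suc n)) 2 w x = E 2 x"
      using el by (intro wderiv_AE chain_is_weak_deriv[OF E]) auto
    ultimately show ?thesis
      using sobolev_element_green[OF el(1) _ s, of v E "wderiv (X n) (X (Suc n)) 2 w"] unfolding tm tp by blast
  qed
  then have "(\<Sum>n<N. LINT x:{X n<..<X (Suc n)}|lebesgue. wderiv (X n) (X (Suc n)) 2 w x * wderiv (X n) (X (Suc n)) 2 v x) =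
      (\<Sum>n<N. E 2 (X (Suc n)) * trace_minus X 1 v (Suc n) - E 2 (X n) * trace_plus X 1 v n)
      - (\<Sum>n<N. E 3 (X (Suc n)) * trace_minus X 0 v (Suc n) - E 3 (X n) * trace_plus X 0 v n)
      + (\<Sum>n<N. integral {X n..X (Suc n)} (\<lambda>x. E 4 x * v x))"
    by (simp add: sum.distrib sum_subtractf)
  also have "(\<Sum>n<N. E 2 (X (Suc n)) * trace_minus X 1 v (Suc n) - E 2 (X n) * trace_plus X 1 v n)
      = (\<Sum>n\<le>N. average N X 2 w n * jump N X 1 v n)"
    using chain_jump_average(2)[OF X \<open>a < b\<close> E, of 2]
    by (subst sum_element_ends_eq_sum_jumps[OF N]) (simp add: jump_def del: One_nat_def)
  also have "(\<Sum>n<N. E 3 (X (Suc n)) * trace_minus X 0 v (Suc n) - E 3 (X n) * trace_plus X 0 v n)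
      = (\<Sum>n\<le>N. average N X 3 w n * jump N X 0 v n)"
    using chain_jump_average(2)[OF X \<open>a < b\<close> E, of 3]
    by (subst sum_element_ends_eq_sum_jumps[OF N]) (simp add: jump_def del: One_nat_def)
  also have "(\<Sum>n<N. integral {X n..X (Suc n)} (\<lambda>x. E 4 x * v x)) = integral {a..b} (\<lambda>x. E 4 x * v x)"
    by (intro integral_mesh[OF X, symmetric] set_lebesgue_integral_eq_integral(1)
        absolutely_integrable_times_continuous(2)[OF vi] deriv_chain_continuous[OF E(1)]) simp
  finally show ?thesis by simp
qed

text \<open>The contribution of the node \<open>n\<close> to \<open>B(w,v)\<close> that carries jumps of the first argument: symmetrization
  and penalty.\<close>

definition boundary_terms ::
  "nat \<Rightarrow> (nat \<Rightarrow> real) \<Rightarrow> real \<Rightarrow> real \<Rightarrow> real \<Rightarrow> (real \<Rightarrow> real) \<Rightarrow> (real \<Rightarrow> real) \<Rightarrow> nat \<Rightarrow> real" where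
  "boundary_terms N X \<sigma>0 \<sigma>1 \<beta> w v n =
     average N X 3 v n * jump N X 0 w n - average N X 2 v n * jump N X 1 w n
     + \<sigma>0 / mesh_size N X powr \<beta> * jump N X 0 w n * jump N X 0 v n
     + \<sigma>1 / mesh_size N X * jump N X 1 w n * jump N X 1 v n"

lemma bilinear_B_boundary_terms:
  "bilinear_B N X \<sigma>0 \<sigma>1 \<beta> w v =
     (\<Sum>n<N. LINT x:{X n<..<X (Suc n)}|lebesgue.
        wderiv (X n) (X (Suc n)) 2 w x * wderiv (X n) (X (Suc n)) 2 v x)
     + (\<Sum>n\<le>N. average N X 3 w n * jump N X 0 v n) - (\<Sum>n\<le>N. average N X 2 w n * jump N X 1 v n)
     + (\<Sum>n\<le>N. boundary_terms N X \<sigma>0 \<sigma>1 \<beta> w v n)"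
  by (simp add: bilinear_B_def boundary_terms_def sum.distrib sum_subtractf algebra_simps)

lemma sum_boundary_terms:
  assumes X: "mesh a b N X" and "a < b"
    and D: "deriv_chain 1 {a..b} D" "\<And>x. x \<in> {a..b} \<Longrightarrow> D 0 x = w x"
  shows "(\<Sum>n\<le>N. boundary_terms N X \<sigma>0 \<sigma>1 \<beta> w v n) =
    boundary_terms N X \<sigma>0 \<sigma>1 \<beta> w v 0 + boundary_terms N X \<sigma>0 \<sigma>1 \<beta> w v N"
proof -
  have N: "N > 0" by (rule mesh_pos[OF X \<open>a < b\<close>])
  have "boundary_terms N X \<sigma>0 \<sigma>1 \<beta> w v n = 0" if "n \<in> {..N} - {0, N}" for n
    using that chain_jump_average(1)[OF X \<open>a < b\<close> D, of 0 n] chain_jump_average(1)[OF X \<open>a < b\<close> D, of 1 n]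
    by (simp add: boundary_terms_def)
  then have "(\<Sum>n\<le>N. boundary_terms N X \<sigma>0 \<sigma>1 \<beta> w v n) = (\<Sum>n\<in>{0, N}. boundary_terms N X \<sigma>0 \<sigma>1 \<beta> w v n)"
    by (intro sum.mono_neutral_right) auto
  then show ?thesis using N by simp
qed

text \<open>An identity that holds on every element can thus be summed without locating the element of \<open>x\<close>.\<close>

lemma sum_indicator_elements:
  assumes X: "mesh a b N X" and x: "x \<in> {a<..<b}" "x \<notin> X ` {..N}"
  shows "(\<Sum>n<N. indicator {X n<..<X (Suc n)} x) = (1::real)"
proof -
  have "(\<Sum>n<M. indicator {X n<..<X (Suc n)} x) = (indicator {X 0<..<X M} x :: real)" if "M \<le> N" for M
    using that
  proof (induction M)
    case (Suc M)
    then have "x \<noteq> X M" "X 0 \<le> X M" "X M \<le> X (Suc M)"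
      using x(2) mesh_mono[OF X, of 0 M] mesh_mono[OF X, of M "Suc M"] by auto
    then show ?case using Suc by (auto simp: indicator_def)
  qed simp
  from this[of N] show ?thesis using X x by (simp add: mesh_def)
qed

lemma l2_inner_broken_deriv:
  assumes X: "mesh a b N X" and v: "v absolutely_integrable_on {a..b}"
    and G: "deriv_chain 1 {a..b} G" "\<And>x. x \<in> {a..b} \<Longrightarrow> G 0 x = g x"
  shows "l2_inner a b (broken_deriv N X 1 g) v = integral {a..b} (\<lambda>x. G 1 x * v x)"
proof -
  have i: "(\<lambda>x. G 1 x * v x) absolutely_integrable_on {a..b}"
    by (intro absolutely_integrable_times_continuous(2)[OF v] deriv_chain_continuous[OF G(1)]) simp
  have "AE x in lebesgue. \<forall>n\<in>{..<N}. x \<in> {X n<..<X (Suc n)} \<longrightarrow> wderiv (X n) (X (Suc n)) 1 g x = G 1 x"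
  proof (intro AE_finite_allI)
    fix n assume "n \<in> {..<N}"
    then have "AE x in lebesgue_on {X n<..<X (Suc n)}. wderiv (X n) (X (Suc n)) 1 g x = G 1 x"
      using mesh_element[OF X, of n] by (intro wderiv_AE chain_is_weak_deriv[OF G]) auto
    then show "AE x in lebesgue. x \<in> {X n<..<X (Suc n)} \<longrightarrow> wderiv (X n) (X (Suc n)) 1 g x = G 1 x"
      by (simp add: AE_restrict_space_iff)
  qed simp
  moreover have "AE x in lebesgue. x \<notin> X ` {..N}"
    by (intro AE_not_in) (simp flip: negligible_iff_null_sets add: negligible_finite)
  ultimately have "AE x in lebesgue. x \<in> {a<..<b} \<longrightarrow> G 1 x * v x = broken_deriv N X 1 g x * v x"
  proof eventually_elim
    case (elim x)
    show ?case
    proof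
      assume x: "x \<in> {a<..<b}"
      have "broken_deriv N X 1 g x = (\<Sum>n<N. indicator {X n<..<X (Suc n)} x * G 1 x)"
        unfolding broken_deriv_def using elim(1) by (intro sum.cong) (auto simp: indicator_def)
      also have "\<dots> = G 1 x"
        using sum_indicator_elements[OF X x elim(2)] by (simp flip: sum_distrib_right)
      finally show "G 1 x * v x = broken_deriv N X 1 g x * v x" by simp
    qed
  qed
  then have "AE x in lebesgue_on {a<..<b}. G 1 x * v x = broken_deriv N X 1 g x * v x"
    by (simp add: AE_restrict_space_iff)
  from absolutely_integrable_cong_AE[OF this i] show ?thesis
    by (simp add: l2_inner_def LINT_open_eq_integral)
qed

text \<open>The differential equation cancels all integrals over elements. What is left contains a jump of \<open>w\<close> or
  of its derivative in every term, and these vanish at interior nodes.\<close>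

lemma weak_form_residual:
  assumes X: "mesh a b N X" and "a < b" and v: "v \<in> broken_sobolev s N X" and s: "s \<ge> 2"
    and E: "deriv_chain 4 {a..b} E" "\<And>x. x \<in> {a..b} \<Longrightarrow> E 0 x = w x"
    and G: "deriv_chain 1 {a..b} G" "\<And>x. x \<in> {a..b} \<Longrightarrow> G 0 x = g x"
    and eq: "\<And>x. x \<in> {a..b} \<Longrightarrow> w x + E 4 x = G 1 x"
  shows "l2_inner a b w v + bilinear_B N X \<sigma>0 \<sigma>1 \<beta> w v - l2_inner a b (broken_deriv N X 1 g) v =
    boundary_terms N X \<sigma>0 \<sigma>1 \<beta> w v 0 + boundary_terms N X \<sigma>0 \<sigma>1 \<beta> w v N"
proof -
  have vi: "v absolutely_integrable_on {a..b}"
    using v X by (auto simp: broken_sobolev_def mesh_def intro: L2_absolutely_integrable)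
  have "continuous_on {a..b} w"
    by (rule deriv_chain_continuous_0[OF E])
  then have wv: "(\<lambda>x. w x * v x) absolutely_integrable_on {a..b}"
    by (rule absolutely_integrable_times_continuous(2)[OF vi])
  have Ev: "(\<lambda>x. E 4 x * v x) absolutely_integrable_on {a..b}"
    by (intro absolutely_integrable_times_continuous(2)[OF vi] deriv_chain_continuous[OF E(1)]) simp
  have "l2_inner a b w v + integral {a..b} (\<lambda>x. E 4 x * v x) = integral {a..b} (\<lambda>x. w x * v x + E 4 x * v x)"
    using wv Ev by (simp add: l2_inner_def LINT_open_eq_integral Henstock_Kurzweil_Integration.integral_add
        set_lebesgue_integral_eq_integral(1))
  also have "\<dots> = integral {a..b} (\<lambda>x. G 1 x * v x)"
    by (intro integral_cong) (simp add: eq flip: distrib_right)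
  also have "\<dots> = l2_inner a b (broken_deriv N X 1 g) v"
    by (rule l2_inner_broken_deriv[OF X vi G, symmetric])
  finally show ?thesis
    using broken_green[OF X \<open>a < b\<close> v s E] sum_boundary_terms[OF X \<open>a < b\<close> deriv_chain_le[OF E(1)] E(2)]
    unfolding bilinear_B_boundary_terms by simp
qed

lemma smooth_in_broken_sobolev:
  assumes X: "mesh a b N X" and "smooth v"
  shows "v \<in> broken_sobolev s N X"
proof -
  have "v \<in> L2 (X 0) (X N)"
    using continuous_L2[OF smooth_continuous[OF assms(2), of _ 0]] by simp
  then show ?thesis
    using mesh_element(1)[OF X] smooth_in_sobolev[OF _ assms(2)] by (simp add: broken_sobolev_def)
qed

text \<open>Tested with a smooth function of compact support in \<open>(a,b)\<close>, the form reduces to the integral of the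
  second derivatives: at interior nodes neither argument jumps, and at the ends the test function and
  its derivatives vanish. Since \<open>w\<close> has a global weak second derivative \<open>q\<close>, the elementwise
  integrals add up to one integral over \<open>(a,b)\<close>.\<close>

lemma weak_form_imp_weak_deriv:
  assumes X: "mesh a b N X" and "a < b"
    and D: "deriv_chain 1 {a..b} D" "\<And>x. x \<in> {a..b} \<Longrightarrow> D 0 x = w x"
    and G: "deriv_chain 1 {a..b} G" "\<And>x. x \<in> {a..b} \<Longrightarrow> G 0 x = g x"
    and w: "w \<in> sobolev 2 a b"
    and W: "\<And>v. v \<in> broken_sobolev s N X \<Longrightarrow>
      l2_inner a b w v + bilinear_B N X \<sigma>0 \<sigma>1 \<beta> w v = l2_inner a b (broken_deriv N X 1 g) v"
  shows "is_weak_deriv a b 4 w (\<lambda>x. G 1 x - w x)"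
proof -
  obtain q where q: "q \<in> L2 a b" "is_weak_deriv a b 2 w q"
    using w unfolding sobolev_def by force
  have qi: "q absolutely_integrable_on {a..b}" by (rule L2_absolutely_integrable[OF q(1)])
  have wc: "continuous_on {a..b} w"
    by (rule deriv_chain_continuous_0[OF D])
  have Gc: "continuous_on {a..b} (G 1)"
    using deriv_chain_continuous[OF G(1), of 1] by simp
  have "(LINT x:{a<..<b}|lebesgue. q x * (deriv ^^ 2) \<phi> x) =
      (- 1) ^ 2 * (LINT x:{a<..<b}|lebesgue. (G 1 x - w x) * \<phi> x)" if \<phi>: "test_function a b \<phi>" for \<phi>
  proof -
    obtain a' b' where ab': "a < a'" "a' < b'" "b' < b" "\<And>x k. x \<notin> {a'<..<b'} \<Longrightarrow> (deriv ^^ k) \<phi> x = 0"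
      by (rule test_function_obtain[OF \<phi>]) blast
    have ends: "(deriv ^^ k) \<phi> a = 0" "(deriv ^^ k) \<phi> b = 0" for k using ab' by auto
    have sm: "smooth \<phi>" using \<phi> by (simp add: test_function_iff)
    have \<phi>c: "continuous_on {a..b} \<phi>" using smooth_continuous[OF sm, of _ 0] by simp
    have \<phi>i: "\<phi> absolutely_integrable_on {a..b}"
      by (rule absolutely_integrable_continuous_real[OF \<phi>c])
    have q2: "(\<lambda>x. q x * (deriv ^^ 2) \<phi> x) absolutely_integrable_on {a..b}"
      by (intro absolutely_integrable_times_continuous(1)[OF qi] smooth_continuous sm)
    note ja = chain_jump_average[OF X \<open>a < b\<close> smooth_chain[OF sm, of 3], of \<phi>]
    have j: "jump N X k \<phi> n = 0" if "k \<le> 3" "n \<le> N" for k n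
      using ja(1)[OF _ that] ends by auto
    have av: "average N X k \<phi> 0 = 0" "average N X k \<phi> N = 0" if "k \<le> 3" for k
      using ja(2)[OF _ that] ends X by (auto simp: mesh_def)
    have "boundary_terms N X \<sigma>0 \<sigma>1 \<beta> w \<phi> 0 + boundary_terms N X \<sigma>0 \<sigma>1 \<beta> w \<phi> N = 0"
      by (simp add: boundary_terms_def av j)
    then have "bilinear_B N X \<sigma>0 \<sigma>1 \<beta> w \<phi> = (\<Sum>n<N. LINT x:{X n<..<X (Suc n)}|lebesgue.
        wderiv (X n) (X (Suc n)) 2 w x * wderiv (X n) (X (Suc n)) 2 \<phi> x)"
      using sum_boundary_terms[OF X \<open>a < b\<close> D, of \<sigma>0 \<sigma>1 \<beta> \<phi>]
      unfolding bilinear_B_boundary_terms by (simp add: j)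
    also have "\<dots> = (\<Sum>n<N. integral {X n..X (Suc n)} (\<lambda>x. q x * (deriv ^^ 2) \<phi> x))"
    proof (rule sum.cong)
      fix n assume "n \<in> {..<N}"
      then have el: "X n < X (Suc n)" "a \<le> X n" "X (Suc n) \<le> b" using mesh_element[OF X, of n] by auto
      have "AE x in lebesgue_on {X n<..<X (Suc n)}. wderiv (X n) (X (Suc n)) 2 w x = q x"
        using el by (intro wderiv_AE is_weak_deriv_restrict[OF q(2)])
      moreover have "AE x in lebesgue_on {X n<..<X (Suc n)}. wderiv (X n) (X (Suc n)) 2 \<phi> x = (deriv ^^ 2) \<phi> x"
        using wderiv_AE[OF is_weak_deriv_classical[OF smooth_chain[OF sm, of 2]]] by simp
      ultimately have "AE x in lebesgue_on {X n<..<X (Suc n)}. q x * (deriv ^^ 2) \<phi> x =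
          wderiv (X n) (X (Suc n)) 2 w x * wderiv (X n) (X (Suc n)) 2 \<phi> x"
        by eventually_elim simp
      from absolutely_integrable_cong_AE[OF this]
      show "(LINT x:{X n<..<X (Suc n)}|lebesgue. wderiv (X n) (X (Suc n)) 2 w x * wderiv (X n) (X (Suc n)) 2 \<phi> x) =
          integral {X n..X (Suc n)} (\<lambda>x. q x * (deriv ^^ 2) \<phi> x)"
        using set_integrable_subset[OF q2, of "{X n..X (Suc n)}"] el by (simp add: LINT_open_eq_integral)
    qed simp
    also have "\<dots> = integral {a..b} (\<lambda>x. q x * (deriv ^^ 2) \<phi> x)"
      by (intro integral_mesh[OF X, symmetric] set_lebesgue_integral_eq_integral(1) q2)
    finally have B: "bilinear_B N X \<sigma>0 \<sigma>1 \<beta> w \<phi> = integral {a..b} (\<lambda>x. q x * (deriv ^^ 2) \<phi> x)" .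
    have i: "(\<lambda>x. w x * \<phi> x) absolutely_integrable_on {a..b}" "(\<lambda>x. G 1 x * \<phi> x) absolutely_integrable_on {a..b}"
      by (intro absolutely_integrable_times_continuous(2)[OF \<phi>i] wc Gc)+
    have "l2_inner a b w \<phi> + integral {a..b} (\<lambda>x. q x * (deriv ^^ 2) \<phi> x) = integral {a..b} (\<lambda>x. G 1 x * \<phi> x)"
      using W[OF smooth_in_broken_sobolev[OF X sm]] B l2_inner_broken_deriv[OF X \<phi>i G] by simp
    then have "integral {a..b} (\<lambda>x. q x * (deriv ^^ 2) \<phi> x) = integral {a..b} (\<lambda>x. G 1 x * \<phi> x - w x * \<phi> x)"
      using i by (simp add: l2_inner_def LINT_open_eq_integral Henstock_Kurzweil_Integration.integral_diff
          set_lebesgue_integral_eq_integral(1))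
    then show ?thesis
      using q2 absolutely_integrable_times_continuous(2)[OF \<phi>i, of "\<lambda>x. G 1 x - w x"] wc Gc
      by (simp add: LINT_open_eq_integral continuous_on_diff left_diff_distrib)
  qed
  moreover have "locally_integrable a b (\<lambda>x. G 1 x - w x)"
    by (intro locally_integrable_absolutely absolutely_integrable_continuous_real continuous_intros wc Gc)
  ultimately have "is_weak_deriv a b (2 + 2) w (\<lambda>x. G 1 x - w x)"
    using is_weak_deriv_trans[OF q(2)] by blast
  then show ?thesis by simp
qed

lemma higher_pderiv_root_power:
  fixes Q :: "real poly"
  assumes "j \<le> k"
  shows "poly ((pderiv ^^ j) ([:-e, 1:] ^ k * Q)) e = (if j = k then fact k * poly Q e else 0)"
  using assms
proof (induction j arbitrary: k Q)
  case (Suc j)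
  then obtain k' where k: "k = Suc k'" "j \<le> k'" by (cases k) auto
  have der: "pderiv ([:-e, 1:] ^ k * Q) = [:-e, 1:] ^ k' * (smult (real k) Q + [:-e, 1:] * pderiv Q)"
    unfolding k(1) pderiv_mult pderiv_power_Suc by (simp add: algebra_simps pderiv_pCons)
  have "poly ((pderiv ^^ Suc j) ([:-e, 1:] ^ k * Q)) e =
      (if j = k' then fact k' * poly (smult (real k) Q + [:-e, 1:] * pderiv Q) e else 0)"
    unfolding funpow_Suc_right o_apply der by (rule Suc.IH[OF k(2)])
  then show ?case using k(1) by simp
qed (auto simp: power_0_left)

text \<open>A multiple of the polynomial \<open>(x - e) ^ k * (x - e') ^ l\<close>.\<close>

lemma exists_smooth_with_prescribed_jet:
  assumes "e \<noteq> e'"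
  obtains v where "smooth v" "\<And>j. j < k \<Longrightarrow> (deriv ^^ j) v e = 0" "(deriv ^^ k) v e = 1"
    "\<And>j. j < l \<Longrightarrow> (deriv ^^ j) v e' = 0"
proof -
  define z where "z = fact k * (e - e') ^ l"
  have z: "z \<noteq> 0" using assms by (simp add: z_def)
  define P where "P = [:-e, 1:] ^ k * smult (1 / z) ([:-e', 1:] ^ l)"
  have P: "P = [:-e', 1:] ^ l * smult (1 / z) ([:-e, 1:] ^ k)" by (simp add: P_def mult.commute)
  show ?thesis
  proof (rule that[of "poly P"])
    show "(deriv ^^ j) (poly P) e = 0" if "j < k" for j
      using that unfolding higher_deriv_poly P_def by (subst higher_pderiv_root_power) auto
    show "(deriv ^^ k) (poly P) e = 1"
      unfolding higher_deriv_poly P_def using z by (subst higher_pderiv_root_power) (auto simp: z_def)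
    show "(deriv ^^ j) (poly P) e' = 0" if "j < l" for j
      using that unfolding higher_deriv_poly P by (subst higher_pderiv_root_power) auto
  qed (rule smooth_poly)
qed

text \<open>For \<open>v\<close> with \<open>v = v' = 0\<close> at both ends the penalty terms vanish. A third derivative concentrated at
  one end isolates the value of \<open>w\<close> there. After that, a second derivative concentrated at one
  end isolates the first derivative of \<open>w\<close>; the third derivative of \<open>v\<close> is then multiplied by zero.\<close>

lemma boundary_terms_eq_0_imp_clamped:
  assumes X: "mesh a b N X" and "a < b"
    and D: "deriv_chain 1 {a..b} D" "\<And>x. x \<in> {a..b} \<Longrightarrow> D 0 x = w x"
    and B: "\<And>v. smooth v \<Longrightarrow>
      boundary_terms N X \<sigma>0 \<sigma>1 \<beta> w v 0 + boundary_terms N X \<sigma>0 \<sigma>1 \<beta> w v N = 0"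
  shows "D 0 a = 0" "D 0 b = 0" "D 1 a = 0" "D 1 b = 0"
proof -
  have N: "N > 0" by (rule mesh_pos[OF X \<open>a < b\<close>])
  have Xab: "X 0 = a" "X N = b" using X by (auto simp: mesh_def)
  have key: "- (deriv ^^ 3) v a * D 0 a + (deriv ^^ 3) v b * D 0 b + (deriv ^^ 2) v a * D 1 a - (deriv ^^ 2) v b * D 1 b = 0"
    if v: "smooth v" "\<And>j. j < 2 \<Longrightarrow> (deriv ^^ j) v a = 0" "\<And>j. j < 2 \<Longrightarrow> (deriv ^^ j) v b = 0" for v
  proof -
    note ja = chain_jump_average[OF X \<open>a < b\<close> smooth_chain[OF v(1), of 3], of v, simplified]
    have "jump N X j v n = 0" if "j < 2" "n \<le> N" for j n
      using ja(1)[of j n] that v(2,3) by auto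
    then show ?thesis
      using B[OF v(1)] ja(2)[of 3 0] ja(2)[of 3 N] ja(2)[of 2 0] ja(2)[of 2 N] N Xab
        chain_jump_average(1)[OF X \<open>a < b\<close> D, of 0] chain_jump_average(1)[OF X \<open>a < b\<close> D, of 1]
      by (simp add: boundary_terms_def)
  qed
  have ab: "a \<noteq> b" "b \<noteq> a" using \<open>a < b\<close> by auto
  obtain v where v: "smooth v" "\<And>j. j < 3 \<Longrightarrow> (deriv ^^ j) v a = 0" "(deriv ^^ 3) v a = 1" "\<And>j. j < 4 \<Longrightarrow> (deriv ^^ j) v b = 0"
    by (rule exists_smooth_with_prescribed_jet[OF ab(1), of 3 4]) blast
  show a0: "D 0 a = 0" using key[OF v(1)] v(2-4) by simp
  obtain v where v: "smooth v" "\<And>j. j < 3 \<Longrightarrow> (deriv ^^ j) v b = 0" "(deriv ^^ 3) v b = 1" "\<And>j. j < 4 \<Longrightarrow> (deriv ^^ j) v a = 0"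
    by (rule exists_smooth_with_prescribed_jet[OF ab(2), of 3 4]) blast
  show b0: "D 0 b = 0" using key[OF v(1)] v(2-4) by simp
  obtain v where v: "smooth v" "\<And>j. j < 2 \<Longrightarrow> (deriv ^^ j) v a = 0" "(deriv ^^ 2) v a = 1" "\<And>j. j < 4 \<Longrightarrow> (deriv ^^ j) v b = 0"
    by (rule exists_smooth_with_prescribed_jet[OF ab(1), of 2 4]) blast
  show "D 1 a = 0" using key[OF v(1)] v(2-4) a0 b0 by simp
  obtain v where v: "smooth v" "\<And>j. j < 2 \<Longrightarrow> (deriv ^^ j) v b = 0" "(deriv ^^ 2) v b = 1" "\<And>j. j < 4 \<Longrightarrow> (deriv ^^ j) v a = 0"
    by (rule exists_smooth_with_prescribed_jet[OF ab(2), of 2 4]) blast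
  show "D 1 b = 0" using key[OF v(1)] v(2-4) a0 b0 by simp
qed

section \<open>Equivalence of the two problems\<close>

lemma nonlinearity_has_deriv:
  "(nonlinearity m c p has_real_derivative (\<Sum>i=1..m. c i * z ^ p i)) (at z)"
proof -
  have "((\<lambda>z. c i * z ^ (p i + 1) / real (p i + 1)) has_real_derivative c i * z ^ p i) (at z)" for i
  proof -
    have "((\<lambda>z. c i * z ^ (p i + 1) / real (p i + 1)) has_real_derivative
        c i * (real (p i + 1) * z ^ (p i + 1 - Suc 0)) / real (p i + 1)) (at z)"
      by (intro DERIV_cdivide DERIV_cmult DERIV_pow)
    then show ?thesis by simp
  qed
  then show ?thesis unfolding nonlinearity_def[abs_def] by (intro DERIV_sum)
qed

lemma nonlinearity_chain:
  assumes "Ck_on 1 {a..b} u"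
  obtains G where "deriv_chain 1 {a..b} G" "\<And>x. x \<in> {a..b} \<Longrightarrow> G 0 x = nonlinearity m c p (u x)"
proof -
  obtain U where U: "\<forall>x\<in>{a..b}. U 0 x = u x" "deriv_chain 1 {a..b} U"
    using assms unfolding Ck_on_iff_chain by blast
  define f' where "f' = (\<lambda>z. \<Sum>i=1..m. c i * z ^ p i)"
  define G where "G = (\<lambda>j x. if j = (0::nat) then nonlinearity m c p (U 0 x) else f' (U 0 x) * U 1 x)"
  show ?thesis
  proof (rule that)
    show "deriv_chain 1 {a..b} G"
      unfolding deriv_chain_def
    proof (intro conjI allI impI ballI)
      fix j :: nat and x assume "j < 1" and x: "x \<in> {a..b}"
      then show "(G j has_real_derivative G (Suc j) x) (at x within {a..b})"
        using DERIV_chain2[OF nonlinearity_has_deriv deriv_chainD[OF U(2) zero_less_one x], of m c p]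
        by (simp add: G_def f'_def)
    qed (use deriv_chain_continuous[OF U(2)] in \<open>auto simp: G_def f'_def intro!: continuous_intros\<close>)
  qed (use U(1) in \<open>simp add: G_def\<close>)
qed

lemma x_deriv_eq:
  assumes "a < b" "x \<in> {a..b}" "(g has_real_derivative d) (at x within {a..b})"
  shows "x_deriv a b g x = d"
  using assms vector_derivative_within_cbox[of a b x g d]
  by (simp add: x_deriv_def has_real_derivative_iff_has_vector_derivative)

lemma Ck1_has_x_deriv:
  assumes "a < b" "Ck_on 1 {a..b} g" "x \<in> {a..b}"
  shows "(g has_real_derivative x_deriv a b g x) (at x within {a..b})"
proof -
  obtain D where D: "\<forall>x\<in>{a..b}. D 0 x = g x" "deriv_chain 1 {a..b} D"
    using assms(2) unfolding Ck_on_iff_chain by blast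
  have "(D 0 has_real_derivative D 1 x) (at x within {a..b})"
    using deriv_chainD[OF D(2), of 0 x] assms(3) by simp
  then have "(g has_real_derivative D 1 x) (at x within {a..b})"
    by (rule has_field_derivative_transform_within[OF _ zero_less_one]) (use assms D(1) in auto)
  then show ?thesis using x_deriv_eq[OF assms(1,3)] by simp
qed

text \<open>The value of \<open>g\<close> at time \<open>0\<close> is not prescribed: a small neighbourhood of \<open>t > 0\<close> does not reach it.\<close>

lemma time_derivative_eq_0:
  fixes g :: "real \<Rightarrow> real"
  assumes g: "(g has_real_derivative d) (at t within {0..T})" and t: "t \<in> {0<..T}"
    and z: "\<And>\<tau>. \<tau> \<in> {0<..T} \<Longrightarrow> g \<tau> = 0"
  shows "d = 0"
proof -
  have "((\<lambda>_. 0) has_real_derivative d) (at t within {0..T})"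
    by (rule has_field_derivative_transform_within[OF g, of t]) (use t z in \<open>auto simp: dist_real_def\<close>)
  then have "((\<lambda>_. 0 :: real) has_vector_derivative d) (at t within {0..T})"
    by (simp add: has_real_derivative_iff_has_vector_derivative)
  then show ?thesis
    using vector_derivative_within_cbox[of 0 T t "\<lambda>_. 0" d] vector_derivative_within_cbox[of 0 T t "\<lambda>_. 0 :: real" 0] t by auto
qed

text \<open>At \<open>0\<close> the function is only continuous, which suffices for the mean value theorem.\<close>

lemma stationary_eq_0:
  fixes g :: "real \<Rightarrow> real"
  assumes g: "\<And>\<tau>. \<tau> \<in> {0<..T} \<Longrightarrow> (g has_real_derivative 0) (at \<tau> within {0..T})"
    and con: "continuous_on {0..T} g" and "g 0 = 0" and t: "t \<in> {0<..T}"
  shows "g t = 0"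
proof -
  have "g t = g 0"
  proof (rule DERIV_isconst2[of 0 t g t])
    show "continuous_on {0..t} g" using con t by (auto intro: continuous_on_subset)
    show "DERIV g x :> 0" if "0 < x" "x < t" for x
      using g[of x] t that by (simp add: at_within_Icc_at)
  qed (use t in auto)
  then show ?thesis using assms by simp
qed

theorem theorem2p1:
  fixes a b T s \<sigma>0 \<sigma>1 \<beta> :: real
    and N m :: nat and X :: "nat \<Rightarrow> real"
    and c :: "nat \<Rightarrow> real" and p :: "nat \<Rightarrow> nat"
    and u0 :: "real \<Rightarrow> real" and u :: "real \<Rightarrow> real \<Rightarrow> real"
  assumes "a < b" and "T > 0" and "mesh a b N X"
    and "\<sigma>0 > 0" and "\<sigma>1 > 0" and "s > 7 / 2"
    and "\<forall>i\<in>{1..m}. p i > 0"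
    and "smooth_evolution a b T u"
  shows "((\<forall>t\<in>{0<..T}. Ck_on 4 {a<..<b} (u t)) \<and>
          solves_P a b T (nonlinearity m c p) u0 u
            \<longrightarrow> solves_W a b T N X s \<sigma>0 \<sigma>1 \<beta> (nonlinearity m c p) u0 u) \<and>
         (clamped a b u0 \<and>
          (\<forall>t\<in>{0<..T}. u t \<in> sobolev 2 a b \<inter> broken_sobolev s N X \<and>
                       t_deriv T u t \<in> sobolev 2 a b \<inter> broken_sobolev s N X) \<and>
          solves_W a b T N X s \<sigma>0 \<sigma>1 \<beta> (nonlinearity m c p) u0 u
            \<longrightarrow> solves_P a b T (nonlinearity m c p) u0 u)"
proof -
  let ?f = "nonlinearity m c p"
  let ?w = "t_deriv T u"
  note X = \<open>mesh a b N X\<close> and ab = \<open>a < b\<close>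
  have uC: "Ck_on 1 {a..b} (u t)" if "t \<in> {0..T}" for t
    using assms(8) that by (simp add: smooth_evolution_def)
  have ucont: "continuous_on {0..T} (\<lambda>t. u t x)" "continuous_on {0..T} (\<lambda>t. x_deriv a b (u t) x)" if "x \<in> {a..b}" for x
    using assms(8) that by (auto simp: smooth_evolution_def)
  have wC: "Ck_on 1 {a..b} (?w t)" if "t \<in> {0<..T}" for t
    using assms(8) that by (simp add: smooth_evolution_def)
  have ut: "((\<lambda>\<tau>. u \<tau> x) has_real_derivative ?w t x) (at t within {0..T})"
    and uxt: "((\<lambda>\<tau>. x_deriv a b (u \<tau>) x) has_real_derivative x_deriv a b (?w t) x) (at t within {0..T})"
    if "t \<in> {0<..T}" "x \<in> {a..b}" for t x
    using assms(8) that by (auto simp: smooth_evolution_def)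
  have ends: "a \<in> {a..b}" "b \<in> {a..b}" using ab by auto
  have sub: "{a<..<b} \<subseteq> {a..b}" by auto
  \<comment> \<open>From the continuous problem to the weak formulation.\<close>
  have forward: "solves_W a b T N X s \<sigma>0 \<sigma>1 \<beta> ?f u0 u" if P: "solves_P a b T ?f u0 u"
    unfolding solves_W_def
  proof (intro conjI ballI)
    fix t v assume t: "t \<in> {0<..T}" and v: "v \<in> broken_sobolev s N X"
    obtain G where G: "deriv_chain 1 {a..b} G" "\<And>x. x \<in> {a..b} \<Longrightarrow> G 0 x = ?f (u t x)"
      using nonlinearity_chain[OF uC, of t m c p] t by auto
    obtain D1 where D1: "\<forall>x\<in>{a..b}. D1 0 x = ?w t x" "deriv_chain 1 {a..b} D1"
      using wC[OF t] unfolding Ck_on_iff_chain by blast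
    have wcont: "continuous_on {a..b} (?w t)"
      using deriv_chain_continuous_0[OF D1(2)] D1(1) by blast
    have rcont: "continuous_on {a..b} (\<lambda>x. G 1 x - ?w t x)"
      using deriv_chain_continuous[OF G(1), of 1] wcont by (simp add: continuous_on_diff)
    obtain D where D: "\<forall>x\<in>{a<..<b}. D 0 x = ?w t x" "deriv_chain 4 {a<..<b} D"
      using P t unfolding solves_P_def Ck_on_iff_chain by blast
    have "D 4 x = G 1 x - ?w t x" if x: "x \<in> {a<..<b}" for x
    proof -
      have "deriv (\<lambda>y. ?f (u t y)) x = G 1 x"
        using deriv_chain_higher_deriv[OF deriv_chain_subset[OF G(1) sub], of "\<lambda>y. ?f (u t y)" 1 x] G(2) x
        by auto
      moreover have "(deriv ^^ 4) (?w t) x = D 4 x"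
        using deriv_chain_higher_deriv[OF D(2) _ D(1), of 4 x] x by simp
      ultimately show ?thesis using P t x unfolding solves_P_def by force
    qed
    then have "AE x in lebesgue_on {a<..<b}. D 4 x = G 1 x - ?w t x"
      by (intro AE_I2) simp
    then have "is_weak_deriv a b 4 (D 0) (\<lambda>x. G 1 x - ?w t x)"
      by (rule is_weak_deriv_cong_AE[OF is_weak_deriv_classical[OF D(2)]])
    then have wd: "is_weak_deriv a b 4 (?w t) (\<lambda>x. G 1 x - ?w t x)"
      by (rule is_weak_deriv_cong) (use D(1) in blast)
    obtain E where E: "deriv_chain 4 {a..b} E" "\<And>x. x \<in> {a..b} \<Longrightarrow> E 0 x = ?w t x"
        "\<And>x. E 4 x = G 1 x - ?w t x"
      by (rule weak_deriv_continuous_imp_chain[OF ab wcont rcont wd]) blast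
    have cl: "u \<tau> e = 0" "x_deriv a b (u \<tau>) e = 0" if "\<tau> \<in> {0<..T}" "e \<in> {a, b}" for \<tau> e
    proof -
      have c: "clamped a b (u \<tau>)" using P that unfolding solves_P_def by blast
      then show "u \<tau> e = 0" using that unfolding clamped_def by auto
      show "x_deriv a b (u \<tau>) e = 0"
        using c that x_deriv_eq[OF ab, of e "u \<tau>" 0] ends unfolding clamped_def by auto
    qed
    \<comment> \<open>The boundary values of \<open>u\<close> vanish at all positive times, hence so do their time derivatives.\<close>
    have z: "E 0 e = 0" "E 1 e = 0" if e: "e \<in> {a, b}" for e
    proof -
      have eab: "e \<in> {a..b}" using e ends by auto
      show "E 0 e = 0"
        using time_derivative_eq_0[OF ut[OF t eab] t] cl(1) e E(2)[OF eab] by simp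
      have "(E 0 has_real_derivative E 1 e) (at e within {a..b})"
        using deriv_chainD[OF E(1), of 0 e] eab by simp
      then have "(?w t has_real_derivative E 1 e) (at e within {a..b})"
        by (rule has_field_derivative_transform_within[OF _ zero_less_one]) (use eab E(2) in auto)
      then have "x_deriv a b (?w t) e = E 1 e" by (rule x_deriv_eq[OF ab eab])
      moreover have "x_deriv a b (?w t) e = 0"
        by (rule time_derivative_eq_0[OF uxt[OF t eab] t]) (use cl(2) e in blast)
      ultimately show "E 1 e = 0" by simp
    qed
    have "jump N X j (?w t) n = 0" if "j \<le> 1" "n \<le> N" for j n
      using chain_jump_average(1)[OF X ab E(1,2), of j n] z that by (auto simp: le_Suc_eq)
    then have "boundary_terms N X \<sigma>0 \<sigma>1 \<beta> (?w t) v n = 0" if "n \<le> N" for n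
      using that by (simp add: boundary_terms_def)
    then show "l2_inner a b (?w t) v + bilinear_B N X \<sigma>0 \<sigma>1 \<beta> (?w t) v
          = l2_inner a b (broken_deriv N X 1 (\<lambda>y. ?f (u t y))) v"
      using weak_form_residual[OF X ab v _ E(1,2) G, of \<sigma>0 \<sigma>1 \<beta>] E(3) assms(6) by simp
  qed (use P in \<open>simp add: solves_P_def\<close>)
  \<comment> \<open>From the weak formulation to the continuous problem.\<close>
  have backward: "solves_P a b T ?f u0 u"
    if u0: "clamped a b u0" and w: "\<forall>t\<in>{0<..T}. ?w t \<in> sobolev 2 a b"
      and W: "solves_W a b T N X s \<sigma>0 \<sigma>1 \<beta> ?f u0 u"
  proof -
    \<comment> \<open>The statement about a single time, including the boundary values of the time derivative.\<close>
    have main: "Ck_on 4 {a<..<b} (?w t) \<and>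
        (\<forall>x\<in>{a<..<b}. (\<lambda>\<tau>. u \<tau> x) differentiable (at t within {0..T}) \<and>
           (\<lambda>y. ?f (u t y)) differentiable (at x) \<and>
           ?w t x + (deriv ^^ 4) (?w t) x = deriv (\<lambda>y. ?f (u t y)) x) \<and>
        (\<forall>e\<in>{a, b}. ?w t e = 0 \<and> x_deriv a b (?w t) e = 0)" if t: "t \<in> {0<..T}" for t
    proof -
      obtain G where G: "deriv_chain 1 {a..b} G" "\<And>x. x \<in> {a..b} \<Longrightarrow> G 0 x = ?f (u t x)"
        using nonlinearity_chain[OF uC, of t m c p] t by auto
      obtain D where D: "\<And>x. x \<in> {a..b} \<Longrightarrow> D 0 x = ?w t x" "deriv_chain 1 {a..b} D"
        using wC[OF t] unfolding Ck_on_iff_chain by blast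
      have wcont: "continuous_on {a..b} (?w t)"
        by (rule deriv_chain_continuous_0[OF D(2,1)])
      have rcont: "continuous_on {a..b} (\<lambda>x. G 1 x - ?w t x)"
        using deriv_chain_continuous[OF G(1), of 1] wcont by (simp add: continuous_on_diff)
      have Wt: "l2_inner a b (?w t) v + bilinear_B N X \<sigma>0 \<sigma>1 \<beta> (?w t) v
          = l2_inner a b (broken_deriv N X 1 (\<lambda>y. ?f (u t y))) v" if "v \<in> broken_sobolev s N X" for v
        using W t that unfolding solves_W_def by blast
      have wd: "is_weak_deriv a b 4 (?w t) (\<lambda>x. G 1 x - ?w t x)"
        using w t by (intro weak_form_imp_weak_deriv[OF X ab D(2,1) G _ Wt]) auto
      obtain E where E: "deriv_chain 4 {a..b} E" "\<And>x. x \<in> {a..b} \<Longrightarrow> E 0 x = ?w t x"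
          "\<And>x. E 4 x = G 1 x - ?w t x"
        by (rule weak_deriv_continuous_imp_chain[OF ab wcont rcont wd]) blast
      have E4: "deriv_chain 4 {a<..<b} E" by (rule deriv_chain_subset[OF E(1)]) auto
      have E1: "deriv_chain 1 {a..b} E" by (rule deriv_chain_le[OF E(1)]) simp
      have "Ck_on 4 {a<..<b} (?w t)"
        unfolding Ck_on_iff_chain using E4 E(2) by (intro exI[of _ E]) auto
      moreover have "(\<lambda>\<tau>. u \<tau> x) differentiable (at t within {0..T}) \<and>
           (\<lambda>y. ?f (u t y)) differentiable (at x) \<and>
           ?w t x + (deriv ^^ 4) (?w t) x = deriv (\<lambda>y. ?f (u t y)) x" if x: "x \<in> {a<..<b}" for x
      proof (intro conjI)
        have xab: "x \<in> {a..b}" using x by auto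
        show "(\<lambda>\<tau>. u \<tau> x) differentiable (at t within {0..T})"
          using ut[OF t xab] by (auto simp: real_differentiable_def)
        have "(G 0 has_real_derivative G 1 x) (at x)"
          using deriv_chainD[OF G(1), of 0 x] x by (simp add: at_within_Icc_at)
        then have fG: "((\<lambda>y. ?f (u t y)) has_real_derivative G 1 x) (at x)"
          by (rule has_field_derivative_transform_within_open[of _ _ _ "{a<..<b}"]) (use x G(2) in auto)
        then show "(\<lambda>y. ?f (u t y)) differentiable (at x)"
          by (auto simp: real_differentiable_def)
        have "(deriv ^^ 4) (?w t) x = E 4 x"
          by (rule deriv_chain_higher_deriv[OF E4]) (use x E(2) in auto)
        then show "?w t x + (deriv ^^ 4) (?w t) x = deriv (\<lambda>y. ?f (u t y)) x"
          using DERIV_imp_deriv[OF fG] E(3) by simp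
      qed
      moreover have "?w t e = 0 \<and> x_deriv a b (?w t) e = 0" if e: "e \<in> {a, b}" for e
      proof -
        have eab: "e \<in> {a..b}" using e ends by auto
        have "boundary_terms N X \<sigma>0 \<sigma>1 \<beta> (?w t) v 0 + boundary_terms N X \<sigma>0 \<sigma>1 \<beta> (?w t) v N = 0"
          if "smooth v" for v
          using weak_form_residual[OF X ab smooth_in_broken_sobolev[OF X that] _ E(1,2) G, of s \<sigma>0 \<sigma>1 \<beta>]
            Wt[OF smooth_in_broken_sobolev[OF X that]] E(3) assms(6) by simp
        note z = boundary_terms_eq_0_imp_clamped[OF X ab E1 E(2) this]
        have "(E 0 has_real_derivative 0) (at e within {a..b})"
          using deriv_chainD[OF E1, of 0 e] eab z e by auto
        then have "(?w t has_real_derivative 0) (at e within {a..b})"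
          by (rule has_field_derivative_transform_within[OF _ zero_less_one]) (use eab E(2) in auto)
        then show ?thesis
          using x_deriv_eq[OF ab eab] z E(2)[OF eab] e by auto
      qed
      ultimately show ?thesis by blast
    qed
    have "clamped a b (u t)" if t: "t \<in> {0<..T}" for t
    proof -
      have T0: "0 \<in> {0..T}" "t \<in> {0..T}" using t by auto
      have init: "u 0 x = u0 x" if "x \<in> {a<..<b}" for x using W that by (simp add: solves_W_def)
      \<comment> \<open>The initial condition holds on the open interval only; continuity of \<open>u 0\<close> carries it to the ends.\<close>
      have z0: "u 0 e = 0 \<and> x_deriv a b (u 0) e = 0" if e: "e \<in> {a, b}" for e
      proof -
        have eab: "e \<in> {a..b}" using e ends by auto
        have d0: "(u0 has_real_derivative 0) (at e within {a..b})" and u0e: "u0 e = 0"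
          using u0 e by (auto simp: clamped_def)
        have ev: "\<forall>\<^sub>F x in at e within {a..b}. u0 x = u 0 x"
          unfolding eventually_at using e init ab
          by (intro exI[of _ "b - a"]) (auto simp: dist_real_def)
        have "(u0 \<longlongrightarrow> 0) (at e within {a..b})"
          using DERIV_continuous[OF d0] u0e by (simp add: continuous_within)
        then have "(u 0 \<longlongrightarrow> 0) (at e within {a..b})"
          by (rule Lim_transform_eventually[OF _ ev])
        moreover have "(u 0 \<longlongrightarrow> u 0 e) (at e within {a..b})"
          using DERIV_continuous[OF Ck1_has_x_deriv[OF ab uC[OF T0(1)] eab]] by (simp add: continuous_within)
        moreover have "at e within {a..b} \<noteq> bot"
          using ab eab by (simp add: trivial_limit_within islimpt_Icc)
        ultimately have ue: "u 0 e = 0" using tendsto_unique by blast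
        have "(u 0 has_real_derivative 0) (at e within {a..b})"
        proof (rule has_field_derivative_transform_within[OF d0, of "b - a"])
          show "u0 x = u 0 x" if "x \<in> {a..b}" "dist x e < b - a" for x
            using that e init[of x] ue u0e by (cases "x = e") (auto simp: dist_real_def)
        qed (use ab eab in auto)
        then show ?thesis using ue x_deriv_eq[OF ab eab] by simp
      qed
      have "u t e = 0 \<and> (u t has_real_derivative 0) (at e within {a..b})" if e: "e \<in> {a, b}" for e
      proof -
        have eab: "e \<in> {a..b}" using e ends by auto
        have "u t e = 0"
          using main e z0 by (intro stationary_eq_0[OF _ ucont(1)[OF eab] _ t]) (use ut[OF _ eab] in force)+
        moreover have "x_deriv a b (u t) e = 0"
          using main e z0 by (intro stationary_eq_0[OF _ ucont(2)[OF eab] _ t]) (use uxt[OF _ eab] in force)+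
        ultimately show ?thesis
          using Ck1_has_x_deriv[OF ab uC[OF T0(2)] eab] by simp
      qed
      then show ?thesis by (simp add: clamped_def)
    qed
    then show ?thesis using main W unfolding solves_P_def solves_W_def by blast
  qed
  show ?thesis using forward backward by blast
qed

end
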